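(* Let $K\ge1$. Equip $(\mathbb C^\times)^{2K}$ with coordinates $y_1,\dots,y_{2K}$ and the Poisson bracket $$\{y_i,y_j\}=(\mathbf P_K)_{ij}\,y_iy_j,$$ where $\mathbf P_K$ is the $2K\times2K$ tridiagonal matrix with $(\mathbf P_K)_{i,i+1}=\frac14$, $(\mathbf P_K)_{i+1,i}=-\frac14$ and all other entries zero. Equip $\mathbb C^{2K+2}\times\mathbb C^\times$, with coordinates $(s_1,\dots,s_{2K+2},\lambda)$, with the (Flaschka--Newell) Poisson bracket $$\{s_j,s_l\}_{FN}=\delta_{j,l-1}-\frac{\delta_{j,1}\delta_{l,2K+2}}{\lambda^2}+(-1)^{j-l+1}s_js_l\quad(j<l),\qquad \{s_j,\lambda\}_{FN}=(-1)^js_j\lambda .$$ Then the parametrization \begin{align*} &s_1=-y_1^{-2},\\ &s_{2k}=(1+y_{2k}^2)\prod_{1\le j\le2k}y_j^{2(-1)^{j+1}},\quad k=1,\dots,K,\\ &s_{2k+1}=-(1+y_{2k+1}^2)\prod_{1\le j\le2k+1}y_j^{2(-1)^{j}},\quad k=1,\dots,K-1,\\ &s_{2K+1}=-\prod_{1\le j\le2K}y_j^{2(-1)^j},\\ &s_{2K+2}=y_1^2\big(1+y_2^2(1+y_3^2(\cdots(1+y_{2K}^2)\cdots))\big)\prod_{j=1}^Ky_{2j}^{-4},\\ &\lambda=\prod_{j=1}^Ky_{2j}^2 \end{align*} of the Stokes parameters $s_j$, $j=1,\dots,2K+2$, and of the formal monodromy exponent $\lambda$ transforms the bracket $\{\cdot,\cdot\}_{FN}$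 into the bracket on the $y_j$'s. That is, computing the brackets of the functions $s_j(y),\lambda(y)$ with the bracket on the $y_j$'s yields the formulas of $\{\cdot,\cdot\}_{FN}$.
   Context: Brackets are extended from coordinate functions as skew-symmetric biderivations. The $s_j$ and $\lambda$ are the Stokes parameters and formal monodromy of rank-two ($sl_2$) polynomial connections of degree $K$ on the Riemann sphere. *)

theory Defs
  imports "HOL-Analysis.Analysis" "HOL-Library.FuncSet"
begin

section \<open>Brackets on products of copies of \<open>\<complex>\<close> and \<open>\<complex>\<^sup>\<times>\<close>\<close>

text \<open>
  The space with coordinates indexed by \<open>I\<close>, where the coordinates in \<open>U \<subseteq> I\<close> range over the
  nonzero complex numbers and the others over all complex numbers.  Points are functions that are
  \<^const>\<open>undefined\<close> outside \<open>I\<close>, and functions on the space are likewise \<^const>\<open>undefined\<close>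
  outside it, so that equality of functions on the space is equality in HOL.
\<close>

definition partial_torus :: "'i set \<Rightarrow> 'i set \<Rightarrow> ('i \<Rightarrow> complex) set" where
  "partial_torus I U = {x \<in> I \<rightarrow>\<^sub>E UNIV. \<forall>i\<in>U. x i \<noteq> 0}"

text \<open>
  The algebra of regular functions: polynomials in the coordinates of \<open>I\<close> and the inverses of
  the coordinates of \<open>U\<close>.
\<close>

inductive_set regular_functions :: "'i set \<Rightarrow> 'i set \<Rightarrow> (('i \<Rightarrow> complex) \<Rightarrow> complex) set"
  for I U :: "'i set" where
  const: "(\<lambda>x\<in>partial_torus I U. c) \<in> regular_functions I U"
| coord: "i \<in> I \<Longrightarrow> (\<lambda>x\<in>partial_torus I U. x i) \<in> regular_functions I U"
| coord_inverse: "i \<in> U \<Longrightarrow> (\<lambda>x\<in>partial_torus I U. inverse (x i)) \<in> regular_functions I U"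
| add: "f \<in> regular_functions I U \<Longrightarrow> g \<in> regular_functions I U \<Longrightarrow>
    (\<lambda>x\<in>partial_torus I U. f x + g x) \<in> regular_functions I U"
| mult: "f \<in> regular_functions I U \<Longrightarrow> g \<in> regular_functions I U \<Longrightarrow>
    (\<lambda>x\<in>partial_torus I U. f x * g x) \<in> regular_functions I U"

definition derivation ::
  "'p set \<Rightarrow> ('p \<Rightarrow> complex) set \<Rightarrow> (('p \<Rightarrow> complex) \<Rightarrow> ('p \<Rightarrow> complex)) \<Rightarrow> bool" where
  "derivation X A d \<longleftrightarrow>
     d \<in> A \<rightarrow> A \<and>
     (\<forall>f\<in>A. \<forall>g\<in>A. \<forall>a b. d (\<lambda>x\<in>X. a * f x + b * g x) = (\<lambda>x\<in>X. a * d f x + b * d g x)) \<and>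
     (\<forall>f\<in>A. \<forall>g\<in>A. d (\<lambda>x\<in>X. f x * g x) = (\<lambda>x\<in>X. f x * d g x + d f x * g x))"

definition skew_biderivation ::
  "'p set \<Rightarrow> ('p \<Rightarrow> complex) set \<Rightarrow> (('p \<Rightarrow> complex) \<Rightarrow> ('p \<Rightarrow> complex) \<Rightarrow> ('p \<Rightarrow> complex)) \<Rightarrow> bool" where
  "skew_biderivation X A B \<longleftrightarrow>
     B \<in> A \<rightarrow>\<^sub>E (A \<rightarrow>\<^sub>E A) \<and>
     (\<forall>f\<in>A. \<forall>g\<in>A. B g f = (\<lambda>x\<in>X. - B f g x)) \<and>
     (\<forall>h\<in>A. derivation X A (\<lambda>f. B f h)) \<and>
     (\<forall>h\<in>A. derivation X A (\<lambda>f. B h f))"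


section \<open>The bracket on \<open>(\<complex>\<^sup>\<times>)\<^bsup>2K\<^esup>\<close>\<close>

definition y_space :: "nat \<Rightarrow> (nat \<Rightarrow> complex) set" where
  "y_space K = partial_torus {1..2*K} {1..2*K}"

definition y_regular :: "nat \<Rightarrow> ((nat \<Rightarrow> complex) \<Rightarrow> complex) set" where
  "y_regular K = regular_functions {1..2*K} {1..2*K}"

text \<open>Rows and columns of the matrix are numbered from \<open>1\<close> to \<open>2K\<close>.\<close>

definition P_matrix :: "nat \<Rightarrow> nat \<Rightarrow> nat \<Rightarrow> complex" where
  "P_matrix K i j =
     (if i \<in> {1..2*K} \<and> j \<in> {1..2*K} then
        if j = i + 1 then 1/4 else if i = j + 1 then -1/4 else 0
      else 0)"

definition is_y_bracket ::
  "nat \<Rightarrow> (((nat \<Rightarrow> complex) \<Rightarrow> complex) \<Rightarrow> ((nat \<Rightarrow> complex) \<Rightarrow> complex) \<Rightarrow> (nat \<Rightarrow> complex) \<Rightarrow> complex) \<Rightarrow> bool"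
where
  "is_y_bracket K B \<longleftrightarrow>
     skew_biderivation (y_space K) (y_regular K) B \<and>
     (\<forall>i\<in>{1..2*K}. \<forall>j\<in>{1..2*K}.
        B (\<lambda>y\<in>y_space K. y i) (\<lambda>y\<in>y_space K. y j) = (\<lambda>y\<in>y_space K. P_matrix K i j * y i * y j))"


section \<open>The Flaschka--Newell bracket on \<open>\<complex>\<^bsup>2K+2\<^esup> \<times> \<complex>\<^sup>\<times>\<close>\<close>

datatype FN_coord = S nat | Lam

definition FN_coords :: "nat \<Rightarrow> FN_coord set" where
  "FN_coords K = S ` {1..2*K+2} \<union> {Lam}"

definition FN_space :: "nat \<Rightarrow> (FN_coord \<Rightarrow> complex) set" where
  "FN_space K = partial_torus (FN_coords K) {Lam}"

definition FN_regular :: "nat \<Rightarrow> ((FN_coord \<Rightarrow> complex) \<Rightarrow> complex) set" where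
  "FN_regular K = regular_functions (FN_coords K) {Lam}"

text \<open>The right-hand side of the formula for \<open>{s\<^sub>j, s\<^sub>l}\<close>; it is meant for \<open>j < l\<close> only.\<close>

definition FN_ss :: "nat \<Rightarrow> nat \<Rightarrow> nat \<Rightarrow> (FN_coord \<Rightarrow> complex) \<Rightarrow> complex" where
  "FN_ss K j l x =
     (if j = l - 1 then 1 else 0)
     - (if j = 1 \<and> l = 2*K+2 then 1 else 0) / (x Lam)^2
     + (-1) powi (int j - int l + 1) * x (S j) * x (S l)"

definition FN_sl :: "nat \<Rightarrow> (FN_coord \<Rightarrow> complex) \<Rightarrow> complex" where
  "FN_sl j x = (-1)^j * x (S j) * x Lam"

definition is_FN_bracket ::
  "nat \<Rightarrow> (((FN_coord \<Rightarrow> complex) \<Rightarrow> complex) \<Rightarrow> ((FN_coord \<Rightarrow> complex) \<Rightarrow> complex) \<Rightarrow> (FN_coord \<Rightarrow> complex) \<Rightarrow> complex) \<Rightarrow> bool"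
where
  "is_FN_bracket K B \<longleftrightarrow>
     skew_biderivation (FN_space K) (FN_regular K) B \<and>
     (\<forall>j\<in>{1..2*K+2}. \<forall>l\<in>{1..2*K+2}. j < l \<longrightarrow>
        B (\<lambda>x\<in>FN_space K. x (S j)) (\<lambda>x\<in>FN_space K. x (S l)) = (\<lambda>x\<in>FN_space K. FN_ss K j l x)) \<and>
     (\<forall>j\<in>{1..2*K+2}.
        B (\<lambda>x\<in>FN_space K. x (S j)) (\<lambda>x\<in>FN_space K. x Lam) = (\<lambda>x\<in>FN_space K. FN_sl j x))"


section \<open>The parametrization\<close>

text \<open>\<open>nested K y = 1 + y\<^sub>2\<^sup>2 (1 + y\<^sub>3\<^sup>2 (\<cdots> (1 + y\<^sub>2\<^sub>K\<^sup>2) \<cdots>))\<close>\<close>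

definition nested :: "nat \<Rightarrow> (nat \<Rightarrow> complex) \<Rightarrow> complex" where
  "nested K y = foldr (\<lambda>j r. 1 + (y j)^2 * r) [2..<2*K+1] 1"

definition stokes :: "nat \<Rightarrow> (nat \<Rightarrow> complex) \<Rightarrow> nat \<Rightarrow> complex" where
  "stokes K y n =
     (if n = 1 then - (y 1 powi (-2))
      else if n = 2*K+2 then
        (y 1)^2 * nested K y * (\<Prod>j=1..K. y (2*j) powi (-4))
      else if n = 2*K+1 then
        - (\<Prod>j=1..2*K. y j powi (2 * (-1)^j))
      else if even n then
        (1 + (y n)^2) * (\<Prod>j=1..n. y j powi (2 * (-1)^(j+1)))
      else
        - (1 + (y n)^2) * (\<Prod>j=1..n. y j powi (2 * (-1)^j)))"

definition monodromy :: "nat \<Rightarrow> (nat \<Rightarrow> complex) \<Rightarrow> complex" where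
  "monodromy K y = (\<Prod>j=1..K. (y (2*j))^2)"

definition param :: "nat \<Rightarrow> (nat \<Rightarrow> complex) \<Rightarrow> FN_coord \<Rightarrow> complex" where
  "param K y = (\<lambda>c\<in>FN_coords K. case c of S n \<Rightarrow> stokes K y n | Lam \<Rightarrow> monodromy K y)"

definition pullback :: "nat \<Rightarrow> ((FN_coord \<Rightarrow> complex) \<Rightarrow> complex) \<Rightarrow> (nat \<Rightarrow> complex) \<Rightarrow> complex" where
  "pullback K f = (\<lambda>y\<in>y_space K. f (param K y))"


section \<open>Existence and uniqueness of the brackets\<close>

lemma regular_sum:
  assumes "finite F" "\<And>k. k \<in> F \<Longrightarrow> h k \<in> regular_functions I U"
  shows "(\<lambda>x\<in>partial_torus I U. \<Sum>k\<in>F. h k x) \<in> regular_functions I U"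
  using assms
proof (induction F rule: finite_induct)
  case empty
  then show ?case using regular_functions.const[of "0" I U] by (simp del: restrict_apply)
next
  case (insert k F)
  have "(\<lambda>x\<in>partial_torus I U. h k x + (\<lambda>x\<in>partial_torus I U. \<Sum>k\<in>F. h k x) x) \<in> regular_functions I U"
    by (rule regular_functions.add) (use insert in auto)
  moreover have "(\<lambda>x\<in>partial_torus I U. h k x + (\<lambda>x\<in>partial_torus I U. \<Sum>k\<in>F. h k x) x)
      = (\<lambda>x\<in>partial_torus I U. \<Sum>k\<in>insert k F. h k x)"
    using insert by (auto intro!: restrict_ext)
  ultimately show ?case by (simp del: restrict_apply)
qed

lemma regular_extensional:
  "f \<in> regular_functions I U \<Longrightarrow> f \<in> extensional (partial_torus I U)"
  by (induction rule: regular_functions.induct) (simp_all del: restrict_apply)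

lemma regular_lincomb:
  assumes "f \<in> regular_functions I U" "g \<in> regular_functions I U"
  shows "(\<lambda>x\<in>partial_torus I U. a * f x + b * g x) \<in> regular_functions I U"
proof -
  let ?X = "partial_torus I U"
  have "(\<lambda>x\<in>?X. (\<lambda>x\<in>?X. (\<lambda>x\<in>?X. a) x * f x) x + (\<lambda>x\<in>?X. (\<lambda>x\<in>?X. b) x * g x) x) \<in> regular_functions I U"
    by (intro regular_functions.intros assms)
  also have "(\<lambda>x\<in>?X. (\<lambda>x\<in>?X. (\<lambda>x\<in>?X. a) x * f x) x + (\<lambda>x\<in>?X. (\<lambda>x\<in>?X. b) x * g x) x)
     = (\<lambda>x\<in>?X. a * f x + b * g x)" by (auto intro!: restrict_ext)
  finally show ?thesis .
qed

lemma derivation_eqI: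
  fixes I U :: "'i set"
  defines "X \<equiv> partial_torus I U" and "A \<equiv> regular_functions I U"
  assumes U: "U \<subseteq> I" and d: "derivation X A d" and d': "derivation X A d'"
    and eq: "\<And>i. i \<in> I \<Longrightarrow> d (\<lambda>x\<in>X. x i) = d' (\<lambda>x\<in>X. x i)"
    and f: "f \<in> A"
  shows "d f = d' f"
proof -
  have one: "(\<lambda>x\<in>X. 1) \<in> A" unfolding X_def A_def by (rule regular_functions.const)
  have zero: "e (\<lambda>x\<in>X. c) = (\<lambda>x\<in>X. 0)" if e: "derivation X A e" for e c
  proof -
    let ?o = "\<lambda>x\<in>X. 1 :: complex"
    have "e (\<lambda>x\<in>X. ?o x * ?o x) = (\<lambda>x\<in>X. ?o x * e ?o x + e ?o x * ?o x)"
      using e one unfolding derivation_def by blast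
    moreover have "(\<lambda>x\<in>X. ?o x * ?o x) = ?o" by (auto intro!: restrict_ext)
    ultimately have E: "e ?o = (\<lambda>x\<in>X. ?o x * e ?o x + e ?o x * ?o x)" by simp
    have z: "e ?o x = 0" if "x \<in> X" for x
      using fun_cong[OF E, of x] that by simp
    have "e (\<lambda>x\<in>X. c * ?o x + 0 * ?o x) = (\<lambda>x\<in>X. c * e ?o x + 0 * e ?o x)"
      using e one unfolding derivation_def by blast
    moreover have "(\<lambda>x\<in>X. c * ?o x + 0 * ?o x) = (\<lambda>x\<in>X. c)" by (auto intro!: restrict_ext)
    ultimately show ?thesis using z by (auto intro!: restrict_ext)
  qed
  have ext: "e g \<in> extensional X" if "derivation X A e" "g \<in> A" for e g
    using that regular_extensional unfolding derivation_def X_def A_def by blast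
  have inv: "e (\<lambda>x\<in>X. inverse (x i)) x = - e (\<lambda>x\<in>X. x i) x / (x i)^2"
    if e: "derivation X A e" and i: "i \<in> U" and x: "x \<in> X" for e i x
  proof -
    let ?c = "\<lambda>x\<in>X. x i :: complex" and ?v = "\<lambda>x\<in>X. inverse (x i) :: complex"
    have m: "?c \<in> A" "?v \<in> A" using i U unfolding X_def A_def
      by (auto intro: regular_functions.intros)
    have nz: "x i \<noteq> 0" if "x \<in> X" for x using that i unfolding X_def partial_torus_def by auto
    have "e (\<lambda>x\<in>X. ?c x * ?v x) = (\<lambda>x\<in>X. ?c x * e ?v x + e ?c x * ?v x)"
      using e m unfolding derivation_def by blast
    moreover have "(\<lambda>x\<in>X. ?c x * ?v x) = (\<lambda>x\<in>X. 1)" using nz by (auto intro!: restrict_ext)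
    ultimately have "(\<lambda>x\<in>X. 0) = (\<lambda>x\<in>X. ?c x * e ?v x + e ?c x * ?v x)" using zero[OF e] by simp
    from fun_cong[OF this, of x] have "x i * e ?v x + e ?c x * inverse (x i) = 0" using x by simp
    then show ?thesis using nz[OF x] by (simp add: field_simps power2_eq_square eq_neg_iff_add_eq_0)
  qed
  show ?thesis using f unfolding A_def
  proof (induction rule: regular_functions.induct)
    case (const c)
    show ?case using zero[OF d] zero[OF d'] unfolding X_def by (simp del: restrict_apply)
  next
    case (coord i)
    then show ?case using eq unfolding X_def by (simp del: restrict_apply)
  next
    case (coord_inverse i)
    have m: "(\<lambda>x\<in>X. inverse (x i)) \<in> A" using coord_inverse unfolding X_def A_def
      by (auto intro: regular_functions.intros)
    show ?case unfolding X_def[symmetric]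
      by (rule extensionalityI[OF ext[OF d m] ext[OF d' m]])
        (use inv[OF d coord_inverse] inv[OF d' coord_inverse] eq coord_inverse U in auto)
  next
    case (add f g)
    have "e (\<lambda>x\<in>X. f x + g x) = (\<lambda>x\<in>X. e f x + e g x)" if e: "derivation X A e" for e
    proof -
      have "e (\<lambda>x\<in>X. 1 * f x + 1 * g x) = (\<lambda>x\<in>X. 1 * e f x + 1 * e g x)"
        using e add unfolding derivation_def A_def by blast
      then show ?thesis by (simp del: restrict_apply)
    qed
    then show ?case using d d' add unfolding X_def by (simp del: restrict_apply)
  next
    case (mult f g)
    have "e (\<lambda>x\<in>X. f x * g x) = (\<lambda>x\<in>X. f x * e g x + e f x * g x)" if e: "derivation X A e" for e
      using e mult unfolding derivation_def A_def by blast
    then show ?case using d d' mult unfolding X_def by (simp del: restrict_apply)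
  qed
qed

lemma restrict_has_partial_derivative:
  assumes i: "i \<in> I" and x: "x \<in> partial_torus I U"
    and h: "((\<lambda>t. h (x(i := t))) has_field_derivative c) (at (x i))"
  shows "((\<lambda>t. (restrict h (partial_torus I U)) (x(i := t))) has_field_derivative c) (at (x i))"
proof (rule has_field_derivative_transform_within_open[OF h])
  have "open {t :: complex. t \<noteq> 0}" by (intro open_Collect_neq continuous_intros)
  then show "open {t :: complex. i \<in> U \<longrightarrow> t \<noteq> 0}" by (cases "i \<in> U") simp_all
  show "x i \<in> {t. i \<in> U \<longrightarrow> t \<noteq> 0}" using x unfolding partial_torus_def by auto
  fix t assume "t \<in> {t :: complex. i \<in> U \<longrightarrow> t \<noteq> 0}"
  then have "x(i := t) \<in> partial_torus I U" using x i unfolding partial_torus_def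
    by (auto simp: PiE_iff extensional_def)
  then show "h (x(i := t)) = (restrict h (partial_torus I U)) (x(i := t))" by simp
qed

lemma regular_partial_derivative:
  fixes I U :: "'i set"
  defines "X \<equiv> partial_torus I U" and "A \<equiv> regular_functions I U"
  assumes U: "U \<subseteq> I" and i: "i \<in> I" and f: "f \<in> A"
  shows "\<exists>d\<in>A. \<forall>x\<in>X. ((\<lambda>t. f (x(i := t))) has_field_derivative d x) (at (x i))"
proof -
  note upd = restrict_has_partial_derivative[OF i, of _ U, folded X_def]
  show ?thesis using f unfolding A_def
  proof (induction rule: regular_functions.induct)
    case (const c)
    have "((\<lambda>t. (\<lambda>x\<in>X. c) (x(i := t))) has_field_derivative (\<lambda>x\<in>X. 0) x) (at (x i))"
      if x: "x \<in> X" for x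
      by (rule upd[OF x]) (use x in simp)
    moreover have "(\<lambda>x\<in>X. 0) \<in> regular_functions I U"
      unfolding X_def by (rule regular_functions.const)
    ultimately show ?case unfolding X_def[symmetric] by blast
  next
    case (coord j)
    have "((\<lambda>t. (\<lambda>x\<in>X. x j) (x(i := t))) has_field_derivative
        (\<lambda>x\<in>X. if j = i then 1 else 0) x) (at (x i))" if x: "x \<in> X" for x
      by (rule upd[OF x]) (use x in \<open>auto intro!: derivative_eq_intros\<close>)
    moreover have "(\<lambda>x\<in>X. if j = i then 1 else 0) \<in> regular_functions I U"
      unfolding X_def by (rule regular_functions.const)
    ultimately show ?case unfolding X_def[symmetric] by blast
  next
    case (coord_inverse j)
    let ?w = "\<lambda>x\<in>X. inverse (x j)"
    let ?d = "\<lambda>x\<in>X. (if j = i then -1 else 0) * (\<lambda>x\<in>X. ?w x * ?w x) x + 0 * ?w x"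
    have "?w \<in> regular_functions I U" unfolding X_def
      by (rule regular_functions.coord_inverse[OF coord_inverse])
    then have "?d \<in> regular_functions I U" unfolding X_def
      by (intro regular_lincomb regular_functions.mult)
    moreover have "((\<lambda>t. ?w (x(i := t))) has_field_derivative ?d x) (at (x i))" if x: "x \<in> X" for x
    proof (rule upd[OF x])
      have "x j \<noteq> 0" using x coord_inverse unfolding X_def partial_torus_def by auto
      then show "((\<lambda>t. inverse ((x(i := t)) j)) has_field_derivative ?d x) (at (x i))"
        using x by (auto intro!: derivative_eq_intros)
    qed
    ultimately show ?case unfolding X_def[symmetric] by blast
  next
    case (add f g)
    then obtain d e where d: "d \<in> regular_functions I U" "e \<in> regular_functions I U"
      and D: "\<And>x. x \<in> X \<Longrightarrow> ((\<lambda>t. f (x(i := t))) has_field_derivative d x) (at (x i))"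
        "\<And>x. x \<in> X \<Longrightarrow> ((\<lambda>t. g (x(i := t))) has_field_derivative e x) (at (x i))" by blast
    have "((\<lambda>t. (\<lambda>x\<in>X. f x + g x) (x(i := t))) has_field_derivative
        (\<lambda>x\<in>X. d x + e x) x) (at (x i))" if x: "x \<in> X" for x
      using DERIV_add[OF D[OF x]] x by (intro upd) auto
    moreover have "(\<lambda>x\<in>X. d x + e x) \<in> regular_functions I U"
      unfolding X_def by (rule regular_functions.add[OF d])
    ultimately show ?case unfolding X_def[symmetric] by blast
  next
    case (mult f g)
    then obtain d e where d: "d \<in> regular_functions I U" "e \<in> regular_functions I U"
      and D: "\<And>x. x \<in> X \<Longrightarrow> ((\<lambda>t. f (x(i := t))) has_field_derivative d x) (at (x i))"
        "\<And>x. x \<in> X \<Longrightarrow> ((\<lambda>t. g (x(i := t))) has_field_derivative e x) (at (x i))" by blast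
    have "(\<lambda>x\<in>X. (\<lambda>x\<in>X. d x * g x) x + (\<lambda>x\<in>X. e x * f x) x) \<in> regular_functions I U"
      unfolding X_def by (intro regular_functions.intros d mult)
    moreover have "((\<lambda>t. (\<lambda>x\<in>X. f x * g x) (x(i := t))) has_field_derivative
        (\<lambda>x\<in>X. (\<lambda>x\<in>X. d x * g x) x + (\<lambda>x\<in>X. e x * f x) x) x) (at (x i))" if x: "x \<in> X" for x
      using DERIV_mult[OF D[OF x]] x by (intro upd) auto
    ultimately show ?case unfolding X_def[symmetric] by blast
  qed
qed

text \<open>
  The extension of given brackets of the coordinates is the bivector field
  \<open>\<Sum>i,j. \<pi> i j * (\<partial>f/\<partial>x\<^sub>i) * (\<partial>g/\<partial>x\<^sub>j)\<close>.
\<close>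

theorem ex1_skew_biderivation:
  fixes I U :: "'i set" and \<pi> :: "'i \<Rightarrow> 'i \<Rightarrow> ('i \<Rightarrow> complex) \<Rightarrow> complex"
  defines "X \<equiv> partial_torus I U" and "A \<equiv> regular_functions I U"
  assumes fin: "finite I" and U: "U \<subseteq> I"
    and pi: "\<And>i j. i \<in> I \<Longrightarrow> j \<in> I \<Longrightarrow> \<pi> i j \<in> A"
    and skew: "\<And>i j x. i \<in> I \<Longrightarrow> j \<in> I \<Longrightarrow> x \<in> X \<Longrightarrow> \<pi> j i x = - \<pi> i j x"
  shows "\<exists>!B. skew_biderivation X A B \<and>
    (\<forall>i\<in>I. \<forall>j\<in>I. B (\<lambda>x\<in>X. x i) (\<lambda>x\<in>X. x j) = \<pi> i j)"
proof (rule ex_ex1I)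
  define D where "D = (\<lambda>i f. SOME d. d \<in> A \<and>
    (\<forall>x\<in>X. ((\<lambda>t. f (x(i := t))) has_field_derivative d x) (at (x i))))"
  have D_props: "D i f \<in> A \<and> (\<forall>x\<in>X. ((\<lambda>t. f (x(i := t))) has_field_derivative D i f x) (at (x i)))"
    if "i \<in> I" "f \<in> A" for i f
    unfolding D_def
    using someI_ex[OF regular_partial_derivative[OF U that(1) that(2)[unfolded A_def],
        unfolded Bex_def, folded X_def A_def]] .
  then have DA: "D i f \<in> A" if "i \<in> I" "f \<in> A" for i f using that by blast
  have D: "((\<lambda>t. f (x(i := t))) has_field_derivative D i f x) (at (x i))"
    if "i \<in> I" "f \<in> A" "x \<in> X" for i f x
    using D_props[OF that(1,2)] that(3) by blast
  note upd = restrict_has_partial_derivative[of _ I _ U, folded X_def]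
  have lin: "(\<lambda>x\<in>X. a * f x + b * g x) \<in> A" if "f \<in> A" "g \<in> A" for f g a b
    unfolding X_def A_def by (rule regular_lincomb) (use that in \<open>simp_all add: A_def\<close>)
  have mul: "(\<lambda>x\<in>X. f x * g x) \<in> A" if "f \<in> A" "g \<in> A" for f g
    unfolding X_def A_def by (rule regular_functions.mult) (use that in \<open>simp_all add: A_def\<close>)
  have crd: "(\<lambda>x\<in>X. x i) \<in> A" if "i \<in> I" for i
    unfolding X_def A_def by (rule regular_functions.coord[OF that])
  have Dlin: "D i (\<lambda>x\<in>X. a * f x + b * g x) x = a * D i f x + b * D i g x"
    if "i \<in> I" "f \<in> A" "g \<in> A" "x \<in> X" for i f g a b x
  proof (rule DERIV_unique[OF D[OF that(1) lin[OF that(2,3)] that(4)]])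
    show "((\<lambda>t. (\<lambda>x\<in>X. a * f x + b * g x) (x(i := t))) has_field_derivative
      a * D i f x + b * D i g x) (at (x i))"
      by (rule upd[OF that(1,4)])
        (rule DERIV_add[OF DERIV_cmult[OF D[OF that(1,2,4)]] DERIV_cmult[OF D[OF that(1,3,4)]]])
  qed
  have Dmul: "D i (\<lambda>x\<in>X. f x * g x) x = f x * D i g x + D i f x * g x"
    if "i \<in> I" "f \<in> A" "g \<in> A" "x \<in> X" for i f g x
  proof (rule DERIV_unique[OF D[OF that(1) mul[OF that(2,3)] that(4)]])
    show "((\<lambda>t. (\<lambda>x\<in>X. f x * g x) (x(i := t))) has_field_derivative
      f x * D i g x + D i f x * g x) (at (x i))"
      by (rule upd[OF that(1,4)])
        (use DERIV_mult[OF D[OF that(1,2,4)] D[OF that(1,3,4)]] in \<open>simp add: algebra_simps\<close>)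
  qed
  have Dcrd: "D i (\<lambda>x\<in>X. x j) x = (if i = j then 1 else 0)"
    if "i \<in> I" "j \<in> I" "x \<in> X" for i j x
  proof (rule DERIV_unique[OF D[OF that(1) crd[OF that(2)] that(3)]])
    show "((\<lambda>t. (\<lambda>x\<in>X. x j) (x(i := t))) has_field_derivative (if i = j then 1 else 0)) (at (x i))"
      by (rule upd[OF that(1,3)]) (auto intro!: derivative_eq_intros)
  qed
  define E where "E = (\<lambda>f g. \<lambda>x\<in>X. \<Sum>i\<in>I. (\<lambda>x\<in>X. \<Sum>j\<in>I.
      (\<lambda>x\<in>X. \<pi> i j x * (\<lambda>x\<in>X. D i f x * D j g x) x) x) x)"
  have EA: "E f g \<in> A" if "f \<in> A" "g \<in> A" for f g
    unfolding E_def X_def A_def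
    by (intro regular_sum fin regular_functions.mult pi[unfolded A_def] DA[unfolded A_def] that[unfolded A_def])
  have E: "E f g x = (\<Sum>i\<in>I. \<Sum>j\<in>I. \<pi> i j x * (D i f x * D j g x))" if "x \<in> X" for f g x
    unfolding E_def using that by simp
  have Eo: "E f g x = undefined" if "x \<notin> X" for f g x
    unfolding E_def using that by simp
  define B where "B = (\<lambda>f\<in>A. \<lambda>g\<in>A. E f g)"
  have BE: "B f g = E f g" if "f \<in> A" "g \<in> A" for f g using that by (simp add: B_def)
  have E_skew: "E g f = (\<lambda>x\<in>X. - E f g x)" if "f \<in> A" "g \<in> A" for f g
  proof
    fix x
    show "E g f x = (\<lambda>x\<in>X. - E f g x) x"
    proof (cases "x \<in> X")
      case True
      have "E g f x = (\<Sum>j\<in>I. \<Sum>i\<in>I. \<pi> j i x * (D j g x * D i f x))" using True by (rule E)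
      also have "\<dots> = (\<Sum>i\<in>I. \<Sum>j\<in>I. \<pi> j i x * (D j g x * D i f x))" by (rule sum.swap)
      also have "\<dots> = (\<Sum>i\<in>I. \<Sum>j\<in>I. - (\<pi> i j x * (D i f x * D j g x)))"
      proof (intro sum.cong refl)
        fix i j assume "i \<in> I" "j \<in> I"
        from skew[OF this True] show "\<pi> j i x * (D j g x * D i f x) = - (\<pi> i j x * (D i f x * D j g x))"
          by simp
      qed
      also have "\<dots> = - E f g x" using E[OF True] by (simp add: sum_negf)
      finally show ?thesis using True by simp
    qed (simp add: Eo)
  qed
  have "B \<in> A \<rightarrow>\<^sub>E (A \<rightarrow>\<^sub>E A)" unfolding B_def using EA by auto
  moreover have "\<forall>f\<in>A. \<forall>g\<in>A. B g f = (\<lambda>x\<in>X. - B f g x)"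
  proof (intro ballI)
    fix f g assume fg: "f \<in> A" "g \<in> A"
    show "B g f = (\<lambda>x\<in>X. - B f g x)" unfolding BE[OF fg] BE[OF fg(2,1)] by (rule E_skew[OF fg])
  qed
  moreover have "derivation X A (\<lambda>f. B f h)" if h: "h \<in> A" for h
    unfolding derivation_def
  proof (intro conjI ballI allI)
    show "(\<lambda>f. B f h) \<in> A \<rightarrow> A" using EA BE h by auto
  next
    fix f g a b assume fg: "f \<in> A" "g \<in> A"
    show "B (\<lambda>x\<in>X. a * f x + b * g x) h = (\<lambda>x\<in>X. a * B f h x + b * B g h x)"
      unfolding BE[OF lin[OF fg] h] BE[OF fg(1) h] BE[OF fg(2) h]
    proof
      fix x show "E (\<lambda>x\<in>X. a * f x + b * g x) h x = (\<lambda>x\<in>X. a * E f h x + b * E g h x) x"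
      proof (cases "x \<in> X")
        case True
        have "E (\<lambda>x\<in>X. a * f x + b * g x) h x = (\<Sum>i\<in>I. \<Sum>j\<in>I. \<pi> i j x * ((a * D i f x + b * D i g x) * D j h x))"
          unfolding E[OF True] by (intro sum.cong refl) (simp only: Dlin[OF _ fg True])
        also have "\<dots> = a * E f h x + b * E g h x"
          unfolding E[OF True] sum_distrib_left sum_distrib_right sum.distrib[symmetric]
          by (intro sum.cong refl) (simp add: algebra_simps)
        finally show ?thesis using True by simp
      qed (simp add: Eo)
    qed
  next
    fix f g assume fg: "f \<in> A" "g \<in> A"
    show "B (\<lambda>x\<in>X. f x * g x) h = (\<lambda>x\<in>X. f x * B g h x + B f h x * g x)"
      unfolding BE[OF mul[OF fg] h] BE[OF fg(1) h] BE[OF fg(2) h]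
    proof
      fix x show "E (\<lambda>x\<in>X. f x * g x) h x = (\<lambda>x\<in>X. f x * E g h x + E f h x * g x) x"
      proof (cases "x \<in> X")
        case True
        have "E (\<lambda>x\<in>X. f x * g x) h x = (\<Sum>i\<in>I. \<Sum>j\<in>I. \<pi> i j x * ((f x * D i g x + D i f x * g x) * D j h x))"
          unfolding E[OF True] by (intro sum.cong refl) (simp only: Dmul[OF _ fg True])
        also have "\<dots> = f x * E g h x + E f h x * g x"
          unfolding E[OF True] sum_distrib_left sum_distrib_right sum.distrib[symmetric]
          by (intro sum.cong refl) (simp add: algebra_simps)
        finally show ?thesis using True by simp
      qed (simp add: Eo)
    qed
  qed
  moreover have "derivation X A (\<lambda>f. B h f)" if h: "h \<in> A" for h
    unfolding derivation_def
  proof (intro conjI ballI allI)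
    show "(\<lambda>f. B h f) \<in> A \<rightarrow> A" using EA BE h by auto
  next
    fix f g a b assume fg: "f \<in> A" "g \<in> A"
    show "B h (\<lambda>x\<in>X. a * f x + b * g x) = (\<lambda>x\<in>X. a * B h f x + b * B h g x)"
      unfolding BE[OF h lin[OF fg]] BE[OF h fg(1)] BE[OF h fg(2)]
    proof
      fix x show "E h (\<lambda>x\<in>X. a * f x + b * g x) x = (\<lambda>x\<in>X. a * E h f x + b * E h g x) x"
      proof (cases "x \<in> X")
        case True
        have "E h (\<lambda>x\<in>X. a * f x + b * g x) x = (\<Sum>i\<in>I. \<Sum>j\<in>I. \<pi> i j x * (D i h x * (a * D j f x + b * D j g x)))"
          unfolding E[OF True] by (intro sum.cong refl) (simp only: Dlin[OF _ fg True])
        also have "\<dots> = a * E h f x + b * E h g x"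
          unfolding E[OF True] sum_distrib_left sum_distrib_right sum.distrib[symmetric]
          by (intro sum.cong refl) (simp add: algebra_simps)
        finally show ?thesis using True by simp
      qed (simp add: Eo)
    qed
  next
    fix f g assume fg: "f \<in> A" "g \<in> A"
    show "B h (\<lambda>x\<in>X. f x * g x) = (\<lambda>x\<in>X. f x * B h g x + B h f x * g x)"
      unfolding BE[OF h mul[OF fg]] BE[OF h fg(1)] BE[OF h fg(2)]
    proof
      fix x show "E h (\<lambda>x\<in>X. f x * g x) x = (\<lambda>x\<in>X. f x * E h g x + E h f x * g x) x"
      proof (cases "x \<in> X")
        case True
        have "E h (\<lambda>x\<in>X. f x * g x) x = (\<Sum>i\<in>I. \<Sum>j\<in>I. \<pi> i j x * (D i h x * (f x * D j g x + D j f x * g x)))"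
          unfolding E[OF True] by (intro sum.cong refl) (simp only: Dmul[OF _ fg True])
        also have "\<dots> = f x * E h g x + E h f x * g x"
          unfolding E[OF True] sum_distrib_left sum_distrib_right sum.distrib[symmetric]
          by (intro sum.cong refl) (simp add: algebra_simps)
        finally show ?thesis using True by simp
      qed (simp add: Eo)
    qed
  qed
  moreover have "B (\<lambda>x\<in>X. x i) (\<lambda>x\<in>X. x j) = \<pi> i j" if ij: "i \<in> I" "j \<in> I" for i j
    unfolding BE[OF crd[OF ij(1)] crd[OF ij(2)]]
  proof
    fix x show "E (\<lambda>x\<in>X. x i) (\<lambda>x\<in>X. x j) x = \<pi> i j x"
    proof (cases "x \<in> X")
      case True
      have "E (\<lambda>x\<in>X. x i) (\<lambda>x\<in>X. x j) x =
          (\<Sum>k\<in>I. \<Sum>l\<in>I. if k = i then if l = j then \<pi> k l x else 0 else 0)"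
        unfolding E[OF True] using ij True by (intro sum.cong refl) (simp add: Dcrd)
      also have "\<dots> = (\<Sum>k\<in>I. if k = i then \<pi> k j x else 0)"
        using ij fin by (intro sum.cong refl) (auto simp: sum.delta)
      also have "\<dots> = \<pi> i j x" using ij fin by (simp add: sum.delta)
      finally show ?thesis .
    next
      case False
      then show ?thesis
        using Eo regular_extensional pi[OF ij] unfolding A_def X_def by (metis extensional_arb)
    qed
  qed
  ultimately show "\<exists>B. skew_biderivation X A B \<and>
      (\<forall>i\<in>I. \<forall>j\<in>I. B (\<lambda>x\<in>X. x i) (\<lambda>x\<in>X. x j) = \<pi> i j)"
    unfolding skew_biderivation_def by blast
next
  fix B B'
  assume "skew_biderivation X A B \<and> (\<forall>i\<in>I. \<forall>j\<in>I. B (\<lambda>x\<in>X. x i) (\<lambda>x\<in>X. x j) = \<pi> i j)"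
    and "skew_biderivation X A B' \<and> (\<forall>i\<in>I. \<forall>j\<in>I. B' (\<lambda>x\<in>X. x i) (\<lambda>x\<in>X. x j) = \<pi> i j)"
  then have B: "B \<in> A \<rightarrow>\<^sub>E (A \<rightarrow>\<^sub>E A)" "\<forall>h\<in>A. derivation X A (\<lambda>f. B f h)" "\<forall>h\<in>A. derivation X A (B h)"
    and B': "B' \<in> A \<rightarrow>\<^sub>E (A \<rightarrow>\<^sub>E A)" "\<forall>h\<in>A. derivation X A (\<lambda>f. B' f h)" "\<forall>h\<in>A. derivation X A (B' h)"
    and c: "\<And>i j. i \<in> I \<Longrightarrow> j \<in> I \<Longrightarrow> B (\<lambda>x\<in>X. x i) (\<lambda>x\<in>X. x j) = B' (\<lambda>x\<in>X. x i) (\<lambda>x\<in>X. x j)"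
    unfolding skew_biderivation_def by auto
  have crd: "(\<lambda>x\<in>X. x i) \<in> A" if "i \<in> I" for i
    unfolding X_def A_def by (rule regular_functions.coord[OF that])
  have 1: "B f (\<lambda>x\<in>X. x j) = B' f (\<lambda>x\<in>X. x j)" if "f \<in> A" "j \<in> I" for f j
    using derivation_eqI[OF U, of "\<lambda>f. B f (\<lambda>x\<in>X. x j)" "\<lambda>f. B' f (\<lambda>x\<in>X. x j)" f]
      B(2) B'(2) c crd that unfolding X_def A_def by blast
  have 2: "B f g = B' f g" if "f \<in> A" "g \<in> A" for f g
    using derivation_eqI[OF U, of "B f" "B' f" g] B(3) B'(3) 1 that unfolding X_def A_def by blast
  show "B = B'"
  proof (rule PiE_ext[OF B(1) B'(1)])
    fix f assume f: "f \<in> A"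
    show "B f = B' f"
      by (rule PiE_ext[of _ A "\<lambda>_. A"]) (use B(1) B'(1) f 2 in auto)
  qed
qed

theorem ex1_y_bracket: "\<exists>!B. is_y_bracket K B"
  unfolding is_y_bracket_def y_space_def y_regular_def
proof (rule ex1_skew_biderivation)
  let ?X = "partial_torus {1..2*K} {1..2*K}" and ?A = "regular_functions {1..2*K} {1..2*K}"
  fix i j assume ij: "i \<in> {1..2*K}" "j \<in> {1..2*K}"
  have "(\<lambda>y\<in>?X. (\<lambda>y\<in>?X. (\<lambda>y\<in>?X. P_matrix K i j) y * (\<lambda>y\<in>?X. y i) y) y * (\<lambda>y\<in>?X. y j) y) \<in> ?A"
    by (intro regular_functions.mult regular_functions.const regular_functions.coord ij)
  also have "(\<lambda>y\<in>?X. (\<lambda>y\<in>?X. (\<lambda>y\<in>?X. P_matrix K i j) y * (\<lambda>y\<in>?X. y i) y) y * (\<lambda>y\<in>?X. y j) y)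
      = (\<lambda>y\<in>?X. P_matrix K i j * y i * y j)"
    by (auto intro!: restrict_ext)
  finally show "(\<lambda>y\<in>?X. P_matrix K i j * y i * y j) \<in> ?A" .
qed (auto simp: P_matrix_def)

theorem ex1_FN_bracket: "\<exists>!B. is_FN_bracket K B"
proof -
  let ?X = "FN_space K" and ?A = "FN_regular K" and ?I = "FN_coords K"
  define \<pi> where "\<pi> = (\<lambda>c d. \<lambda>x\<in>?X. case (c, d) of
      (S j, S l) \<Rightarrow> (if j < l then FN_ss K j l x else if l < j then - FN_ss K l j x else 0)
    | (S j, Lam) \<Rightarrow> FN_sl j x | (Lam, S l) \<Rightarrow> - FN_sl l x | (Lam, Lam) \<Rightarrow> 0)"
  have const: "(\<lambda>x\<in>?X. c) \<in> ?A" for c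
    unfolding FN_space_def FN_regular_def by (rule regular_functions.const)
  have coord: "(\<lambda>x\<in>?X. x c) \<in> ?A" if "c \<in> ?I" for c
    using that unfolding FN_space_def FN_regular_def by (rule regular_functions.coord)
  have inv: "(\<lambda>x\<in>?X. inverse (x Lam)) \<in> ?A"
    unfolding FN_space_def FN_regular_def by (rule regular_functions.coord_inverse) simp
  have add: "(\<lambda>x\<in>?X. f x + g x) \<in> ?A" and mult: "(\<lambda>x\<in>?X. f x * g x) \<in> ?A"
    if "(\<lambda>x\<in>?X. f x) \<in> ?A" "(\<lambda>x\<in>?X. g x) \<in> ?A" for f g
    using regular_functions.add[OF that[unfolded FN_space_def FN_regular_def]]
      regular_functions.mult[OF that[unfolded FN_space_def FN_regular_def]]
    unfolding FN_space_def FN_regular_def by (simp_all cong: restrict_cong)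
  have neg: "(\<lambda>x\<in>?X. - f x) \<in> ?A" if "(\<lambda>x\<in>?X. f x) \<in> ?A" for f
    using mult[OF const[of "-1"] that] by simp
  have ss: "(\<lambda>x\<in>?X. FN_ss K j l x) \<in> ?A" if "S j \<in> ?I" "S l \<in> ?I" for j l
  proof -
    let ?c = "if j = 1 \<and> l = 2*K+2 then 1 else 0 :: complex"
    have "(\<lambda>x\<in>?X. ((if j = l - 1 then 1 else 0) + (- ?c) * (inverse (x Lam) * inverse (x Lam)))
        + (-1) powi (int j - int l + 1) * x (S j) * x (S l)) \<in> ?A"
      by (intro add mult const coord inv that)
    then show ?thesis unfolding FN_ss_def by (simp add: power2_eq_square divide_inverse)
  qed
  have sl: "(\<lambda>x\<in>?X. FN_sl j x) \<in> ?A" if "S j \<in> ?I" for j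
    unfolding FN_sl_def by (intro mult const coord that) (simp add: FN_coords_def)
  have "\<exists>!B. skew_biderivation ?X ?A B \<and> (\<forall>c\<in>?I. \<forall>d\<in>?I. B (\<lambda>x\<in>?X. x c) (\<lambda>x\<in>?X. x d) = \<pi> c d)"
    unfolding FN_space_def FN_regular_def
  proof (rule ex1_skew_biderivation)
    show "finite ?I" "{Lam} \<subseteq> ?I" by (auto simp: FN_coords_def)
    show "\<pi> c d \<in> regular_functions ?I {Lam}" if "c \<in> ?I" "d \<in> ?I" for c d
      unfolding FN_regular_def[symmetric] \<pi>_def
    proof (cases c; cases d)
      fix j l assume c: "c = S j" "d = S l"
      consider "j < l" | "l < j" | "j = l" by linarith
      then show "(\<lambda>x\<in>?X. case (c, d) of
          (S j, S l) \<Rightarrow> (if j < l then FN_ss K j l x else if l < j then - FN_ss K l j x else 0)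
        | (S j, Lam) \<Rightarrow> FN_sl j x | (Lam, S l) \<Rightarrow> - FN_sl l x | (Lam, Lam) \<Rightarrow> 0) \<in> ?A"
        using that c ss[of j l] neg[OF ss, of l j] const[of 0]
        by cases (simp_all del: restrict_apply)
    qed (use that sl neg[OF sl] const[of 0] in \<open>simp_all del: restrict_apply\<close>)
    show "\<pi> d c x = - \<pi> c d x" if "x \<in> partial_torus ?I {Lam}" for c d x
      using that unfolding \<pi>_def FN_space_def by (cases c; cases d) auto
  qed
  moreover have "(skew_biderivation ?X ?A B \<and>
      (\<forall>c\<in>?I. \<forall>d\<in>?I. B (\<lambda>x\<in>?X. x c) (\<lambda>x\<in>?X. x d) = \<pi> c d)) \<longleftrightarrow> is_FN_bracket K B" for B
  proof
    assume L: "skew_biderivation ?X ?A B \<and> (\<forall>c\<in>?I. \<forall>d\<in>?I. B (\<lambda>x\<in>?X. x c) (\<lambda>x\<in>?X. x d) = \<pi> c d)"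
    then show "is_FN_bracket K B"
      unfolding is_FN_bracket_def by (auto simp: \<pi>_def FN_coords_def)
  next
    assume R: "is_FN_bracket K B"
    then have bd: "skew_biderivation ?X ?A B" unfolding is_FN_bracket_def by blast
    then have sk: "B g f = (\<lambda>x\<in>?X. - B f g x)" if "f \<in> ?A" "g \<in> ?A" for f g
      using that unfolding skew_biderivation_def by blast
    have self: "B f f = (\<lambda>x\<in>?X. 0)" if f: "f \<in> ?A" for f
    proof
      fix x
      have "B f f x = (\<lambda>x\<in>?X. - B f f x) x" using sk[OF f f] by (rule fun_cong)
      then show "B f f x = (\<lambda>x\<in>?X. 0) x" by (cases "x \<in> ?X") auto
    qed
    have "B (\<lambda>x\<in>?X. x c) (\<lambda>x\<in>?X. x d) = \<pi> c d" if cd: "c \<in> ?I" "d \<in> ?I" for c d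
    proof (cases c; cases d)
      fix j l assume c: "c = S j" "d = S l"
      consider "j < l" | "l < j" | "j = l" by linarith
      then show ?thesis
      proof cases
        case 1
        then show ?thesis using R cd c unfolding is_FN_bracket_def \<pi>_def FN_coords_def by auto
      next
        case 2
        then have "B (\<lambda>x\<in>?X. x d) (\<lambda>x\<in>?X. x c) = (\<lambda>x\<in>?X. FN_ss K l j x)"
          using R cd c unfolding is_FN_bracket_def FN_coords_def by auto
        then show ?thesis using sk[OF coord[OF cd(2)] coord[OF cd(1)]] 2 c
          unfolding \<pi>_def by (auto intro!: restrict_ext)
      next
        case 3
        then show ?thesis using self[OF coord[OF cd(1)]] c unfolding \<pi>_def by auto
      qed
    next
      fix j assume c: "c = S j" "d = Lam"
      then show ?thesis using R cd unfolding is_FN_bracket_def \<pi>_def FN_coords_def by auto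
    next
      fix l assume c: "c = Lam" "d = S l"
      then have "B (\<lambda>x\<in>?X. x d) (\<lambda>x\<in>?X. x c) = (\<lambda>x\<in>?X. FN_sl l x)"
        using R cd unfolding is_FN_bracket_def FN_coords_def by auto
      then show ?thesis using sk[OF coord[OF cd(2)] coord[OF cd(1)]] c
        unfolding \<pi>_def by (auto intro!: restrict_ext)
    next
      assume c: "c = Lam" "d = Lam"
      then show ?thesis using self[OF coord[OF cd(1)]] unfolding \<pi>_def by auto
    qed
    then show "skew_biderivation ?X ?A B \<and> (\<forall>c\<in>?I. \<forall>d\<in>?I. B (\<lambda>x\<in>?X. x c) (\<lambda>x\<in>?X. x d) = \<pi> c d)"
      using bd by blast
  qed
  ultimately show ?thesis by simp
qed

end

theory Submission
  imports Defs
begin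

text \<open>
  Put \<open>u\<^sub>i = y\<^sub>i\<^sup>2\<close>, so that \<open>{log u\<^sub>i, log u\<^sub>i\<^sub>+\<^sub>1} = 1\<close> and the bracket of two Laurent monomials in the
  \<open>u\<^sub>i\<close> is a constant times their product.  The monomials
  \<open>a\<^sub>n = \<Prod>i\<le>n. u\<^sub>i powi (-1)^(n+i+1)\<close> satisfy \<open>{a\<^sub>j, a\<^sub>l} = (-1)^(j+l+1) a\<^sub>j a\<^sub>l\<close> for
  \<open>j < l\<close>, and \<open>s\<^sub>n = (-1)^n (a\<^sub>n + 1/a\<^sub>n\<^sub>-\<^sub>1)\<close> for \<open>n \<le> 2K+1\<close> if \<open>1/a\<^sub>0\<close> and \<open>a\<close> with index \<open>2K+1\<close>
  are read as \<open>0\<close>.  Hence \<open>{s\<^sub>j, s\<^sub>l} = (-1)^(j+l+1) s\<^sub>j s\<^sub>l\<close>, except that for \<open>l = j + 1\<close> the term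
  \<open>{a\<^sub>j, 1/a\<^sub>j} = 0\<close> leaves the correction \<open>a\<^sub>j (1/a\<^sub>j) = 1\<close>.

  The last Stokes parameter is the sum of \<open>w\<^sub>n = u\<^sub>1 \<cdots> u\<^sub>n / \<lambda>\<^sup>2\<close> over \<open>1 \<le> n \<le> 2K\<close>, and
  \<open>{a\<^sub>k, w\<^sub>n} = ((-1)^(k+1) + \<delta>\<^sub>k\<^sub>n) a\<^sub>k w\<^sub>n\<close>.  In \<open>{s\<^sub>j, \<Sum> w\<^sub>n}\<close> the \<open>\<delta>\<close>-terms cancel because
  \<open>a\<^sub>j w\<^sub>j = w\<^sub>j\<^sub>-\<^sub>1 / a\<^sub>j\<^sub>-\<^sub>1\<close>; only the boundary terms at \<open>j = 1\<close> and \<open>j = 2K+1\<close> survive, which are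
  \<open>-1/\<lambda>\<^sup>2\<close> and \<open>1\<close>.

  The passage from coordinates to arbitrary regular functions rests on the fact that two
  derivations at a point that agree on the coordinates agree on all regular functions.
\<close>

section \<open>Derivations at a point\<close>

text \<open>\<open>restrict_apply\<close> would rewrite even unapplied restrictions into conditional expressions.\<close>

declare restrict_apply [simp del] restrict_apply' [simp]

text \<open>Fixing one slot of a bracket and composing with \<open>pullback\<close> maps
  \<open>FN_regular K\<close> into another algebra, so the result is not a
  \<open>derivation\<close>. At a single point it still obeys Leibniz' rule with scalar values, and
  this is enough to compare brackets.\<close>

definition point_derivation ::
  "'p set \<Rightarrow> ('p \<Rightarrow> complex) set \<Rightarrow> 'p \<Rightarrow> (('p \<Rightarrow> complex) \<Rightarrow> complex) \<Rightarrow> bool" where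
  "point_derivation X A x \<delta> \<longleftrightarrow>
     (\<forall>f\<in>A. \<forall>g\<in>A. \<forall>a b. \<delta> (\<lambda>x\<in>X. a * f x + b * g x) = a * \<delta> f + b * \<delta> g) \<and>
     (\<forall>f\<in>A. \<forall>g\<in>A. \<delta> (\<lambda>x\<in>X. f x * g x) = f x * \<delta> g + \<delta> f * g x)"

lemma point_derivation_lincomb:
  "point_derivation X A x \<delta> \<Longrightarrow> f \<in> A \<Longrightarrow> g \<in> A \<Longrightarrow>
    \<delta> (\<lambda>x\<in>X. a * f x + b * g x) = a * \<delta> f + b * \<delta> g"
  unfolding point_derivation_def by blast

lemma point_derivation_mult:
  "point_derivation X A x \<delta> \<Longrightarrow> f \<in> A \<Longrightarrow> g \<in> A \<Longrightarrow>
    \<delta> (\<lambda>x\<in>X. f x * g x) = f x * \<delta> g + \<delta> f * g x"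
  unfolding point_derivation_def by blast

lemma derivation_at_point:
  assumes "derivation X A d" "x \<in> X"
  shows "point_derivation X A x (\<lambda>f. d f x)"
  using assms unfolding derivation_def point_derivation_def by simp

text \<open>Leibniz' rule for \<open>1 * 1 = 1\<close> makes the value at 1 equal to twice itself;
  linearity does the rest.\<close>

lemma point_derivation_const:
  assumes d: "point_derivation X A x \<delta>" and one: "(\<lambda>x\<in>X. 1) \<in> A" and x: "x \<in> X"
  shows "\<delta> (\<lambda>x\<in>X. c) = 0"
proof -
  let ?o = "\<lambda>x\<in>X. 1 :: complex"
  have "(\<lambda>x\<in>X. ?o x * ?o x) = ?o" by (auto intro!: restrict_ext)
  then have "\<delta> ?o = 0"
    using point_derivation_mult[OF d one one] x by simp
  moreover have "(\<lambda>x\<in>X. c * ?o x + 0 * ?o x) = (\<lambda>x\<in>X. c)" by (auto intro!: restrict_ext)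
  ultimately show ?thesis
    using point_derivation_lincomb[OF d one one, of c 0] by simp
qed

text \<open>Differentiate the identity \<open>x i * inverse (x i) = 1\<close>.\<close>

lemma point_derivation_inverse:
  fixes I U :: "'i set"
  defines "X \<equiv> partial_torus I U" and "A \<equiv> regular_functions I U"
  assumes U: "U \<subseteq> I" and d: "point_derivation X A x \<delta>" and x: "x \<in> X" and i: "i \<in> U"
  shows "\<delta> (\<lambda>x\<in>X. inverse (x i)) = - \<delta> (\<lambda>x\<in>X. x i) * inverse (x i) * inverse (x i)"
proof -
  let ?c = "\<lambda>x\<in>X. x i :: complex" and ?v = "\<lambda>x\<in>X. inverse (x i) :: complex"
  have m: "?c \<in> A" "?v \<in> A" "(\<lambda>x\<in>X. 1) \<in> A"
    using i U unfolding X_def A_def by (auto intro: regular_functions.intros)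
  have nz: "z i \<noteq> 0" if "z \<in> X" for z using that i unfolding X_def partial_torus_def by auto
  have "(\<lambda>x\<in>X. ?c x * ?v x) = (\<lambda>x\<in>X. 1)" using nz by (auto intro!: restrict_ext)
  then have "x i * \<delta> ?v + \<delta> ?c * inverse (x i) = 0"
    using point_derivation_mult[OF d m(1,2)] point_derivation_const[OF d m(3) x, of 1] x by simp
  then have "x i * \<delta> ?v = - \<delta> ?c * inverse (x i)"
    by (simp only: eq_neg_iff_add_eq_0 mult_minus_left)
  then show ?thesis using nz[OF x] by (simp add: field_simps)
qed

text \<open>Induction over the generation of regular functions; on inverse coordinates the value is
  forced by \<open>point_derivation_inverse\<close>.\<close>

lemma point_derivation_eqI:
  fixes I U :: "'i set"
  defines "X \<equiv> partial_torus I U" and "A \<equiv> regular_functions I U"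
  assumes U: "U \<subseteq> I" and x: "x \<in> X"
    and d: "point_derivation X A x \<delta>" "point_derivation X A x \<delta>'"
    and eq: "\<And>i. i \<in> I \<Longrightarrow> \<delta> (\<lambda>x\<in>X. x i) = \<delta>' (\<lambda>x\<in>X. x i)"
    and f: "f \<in> A"
  shows "\<delta> f = \<delta>' f"
  using f unfolding A_def
proof (induction rule: regular_functions.induct)
  case (const c)
  have "(\<lambda>x\<in>X. 1) \<in> A" unfolding X_def A_def by (rule regular_functions.const)
  then show ?case
    using d x point_derivation_const unfolding X_def by metis
next
  case (coord i)
  then show ?case using eq unfolding X_def by blast
next
  case (coord_inverse i)
  then show ?case
    using point_derivation_inverse[OF U _ _ coord_inverse, folded X_def A_def, OF d(1) x]
      point_derivation_inverse[OF U _ _ coord_inverse, folded X_def A_def, OF d(2) x] eq U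
    unfolding X_def by (metis subsetD)
next
  case (add f g)
  then show ?case
    using point_derivation_lincomb[OF d(1), of f g 1 1] point_derivation_lincomb[OF d(2), of f g 1 1]
    unfolding X_def A_def by simp
next
  case (mult f g)
  then show ?case
    using point_derivation_mult[OF d(1), of f g] point_derivation_mult[OF d(2), of f g]
    unfolding X_def A_def by simp
qed

lemma regular_multI:
  assumes "restrict f (partial_torus I U) \<in> regular_functions I U"
    and "restrict g (partial_torus I U) \<in> regular_functions I U"
  shows "(\<lambda>x\<in>partial_torus I U. f x * g x) \<in> regular_functions I U"
  using regular_functions.mult[OF assms] by (simp cong: restrict_cong)

text \<open>\<open>c\<close> and \<open>c'\<close> act as logarithmic derivatives, which add under
  products; the form without division also covers zeros of \<open>f\<close> and
  \<open>g\<close>.\<close>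

lemma point_derivation_multI:
  fixes X :: "'p set"
  assumes "point_derivation X A x \<delta>" "x \<in> X" "restrict f X \<in> A" "restrict g X \<in> A"
    and "\<delta> (restrict f X) = c * f x" "\<delta> (restrict g X) = c' * g x"
  shows "\<delta> (\<lambda>x\<in>X. f x * g x) = (c + c') * (f x * g x)"
proof -
  have "(\<lambda>x\<in>X. restrict f X x * restrict g X x) = (\<lambda>x\<in>X. f x * g x)"
    by (auto intro!: restrict_ext)
  then show ?thesis
    using point_derivation_mult[OF assms(1,3,4)] assms(2,5,6) by (simp add: algebra_simps)
qed

text \<open>Integer induction runs up and down from 0; each step multiplies by the coordinate or its
  inverse and changes the logarithmic derivative by \<open>c\<close> or \<open>- c\<close>.\<close>

lemma regular_power_int:
  fixes I U :: "'i set"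
  defines "X \<equiv> partial_torus I U" and "A \<equiv> regular_functions I U"
  assumes U: "U \<subseteq> I" and i: "i \<in> U"
  shows "(\<lambda>x\<in>X. x i powi n) \<in> A"
    and "point_derivation X A x \<delta> \<Longrightarrow> x \<in> X \<Longrightarrow> \<delta> (\<lambda>x\<in>X. x i) = c * x i \<Longrightarrow>
      \<delta> (\<lambda>x\<in>X. x i powi n) = of_int n * c * x i powi n"
proof -
  have nz: "z i \<noteq> 0" if "z \<in> X" for z using that i unfolding X_def partial_torus_def by auto
  have m: "(\<lambda>x\<in>X. x i) \<in> A" "(\<lambda>x\<in>X. inverse (x i)) \<in> A" "(\<lambda>x\<in>X. 1) \<in> A"
    using i U unfolding X_def A_def by (auto intro: regular_functions.intros)
  have up: "(\<lambda>x\<in>X. x i powi (k + 1)) = (\<lambda>x\<in>X. x i powi k * x i)" for k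
    using nz by (auto intro!: restrict_ext simp: power_int_add)
  have down: "(\<lambda>x\<in>X. x i powi (k - 1)) = (\<lambda>x\<in>X. x i powi k * inverse (x i))" for k
    using nz by (auto intro!: restrict_ext simp: power_int_diff divide_inverse)
  show reg: "(\<lambda>x\<in>X. x i powi n) \<in> A" for n
  proof (induction n rule: int_induct[of _ 0])
    case base
    then show ?case using m by simp
  next
    case (step1 k)
    then show ?case unfolding up using m unfolding X_def A_def by (intro regular_multI)
  next
    case (step2 k)
    then show ?case unfolding down using m unfolding X_def A_def by (intro regular_multI)
  qed
  assume d: "point_derivation X A x \<delta>" and x: "x \<in> X" and c: "\<delta> (\<lambda>x\<in>X. x i) = c * x i"
  have c': "\<delta> (\<lambda>x\<in>X. inverse (x i)) = - c * inverse (x i)"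
    using point_derivation_inverse[OF U d[unfolded X_def A_def] x[unfolded X_def] i] c nz[OF x]
    unfolding X_def by simp
  show "\<delta> (\<lambda>x\<in>X. x i powi n) = of_int n * c * x i powi n"
  proof (induction n rule: int_induct[of _ 0])
    case base
    then show ?case using point_derivation_const[OF d m(3) x] by simp
  next
    case (step1 k)
    have "\<delta> (\<lambda>x\<in>X. x i powi k * x i) = (of_int k * c + c) * (x i powi k * x i)"
      by (rule point_derivation_multI[where f = "\<lambda>x. x i powi k" and g = "\<lambda>x. x i", OF d x reg m(1) step1(2) c])
    then show ?case unfolding up using nz[OF x] by (simp add: power_int_add algebra_simps)
  next
    case (step2 k)
    have "\<delta> (\<lambda>x\<in>X. x i powi k * inverse (x i)) = (of_int k * c + - c) * (x i powi k * inverse (x i))"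
      by (rule point_derivation_multI[where f = "\<lambda>x. x i powi k" and g = "\<lambda>x. inverse (x i)", OF d x reg m(2) step2(2) c'])
    then show ?case unfolding down using nz[OF x]
      by (simp add: power_int_diff divide_inverse algebra_simps)
  qed
qed

text \<open>The logarithmic derivative of a monomial is linear in its exponents.\<close>

lemma regular_monomial:
  fixes I U :: "'i set"
  defines "X \<equiv> partial_torus I U" and "A \<equiv> regular_functions I U"
  assumes U: "U \<subseteq> I" and F: "finite F" "F \<subseteq> U"
  shows "(\<lambda>x\<in>X. \<Prod>i\<in>F. x i powi e i) \<in> A"
    and "point_derivation X A x \<delta> \<Longrightarrow> x \<in> X \<Longrightarrow>
      (\<And>i. i \<in> F \<Longrightarrow> \<delta> (\<lambda>x\<in>X. x i) = c i * x i) \<Longrightarrow>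
      \<delta> (\<lambda>x\<in>X. \<Prod>i\<in>F. x i powi e i) = (\<Sum>i\<in>F. of_int (e i) * c i) * (\<Prod>i\<in>F. x i powi e i)"
proof -
  have one: "(\<lambda>x\<in>X. 1) \<in> A" unfolding X_def A_def by (rule regular_functions.const)
  have pw: "(\<lambda>x\<in>X. x i powi n) \<in> A" if "i \<in> U" for i n
    using regular_power_int(1)[OF U that] unfolding X_def A_def .
  have reg: "(\<lambda>x\<in>X. \<Prod>i\<in>G. x i powi e i) \<in> A" if "finite G" "G \<subseteq> U" for G
    using that
  proof (induction G rule: finite_induct)
    case empty
    then show ?case using one by simp
  next
    case (insert i G)
    have "(\<lambda>x\<in>X. x i powi e i * (\<Prod>i\<in>G. x i powi e i)) \<in> A"
      using insert pw unfolding X_def A_def by (intro regular_multI) auto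
    then show ?case using insert by simp
  qed
  then show "(\<lambda>x\<in>X. \<Prod>i\<in>F. x i powi e i) \<in> A" using F .
  assume d: "point_derivation X A x \<delta>" and x: "x \<in> X"
    and c: "\<And>i. i \<in> F \<Longrightarrow> \<delta> (\<lambda>x\<in>X. x i) = c i * x i"
  have pd: "\<delta> (\<lambda>x\<in>X. x i powi n) = of_int n * c i * x i powi n" if "i \<in> F" for i n
    using regular_power_int(2)[OF U _ d[unfolded X_def A_def] x[unfolded X_def]] c F that
    unfolding X_def A_def by blast
  show "\<delta> (\<lambda>x\<in>X. \<Prod>i\<in>F. x i powi e i) = (\<Sum>i\<in>F. of_int (e i) * c i) * (\<Prod>i\<in>F. x i powi e i)"
    using F pd
  proof (induction F rule: finite_induct)
    case empty
    then show ?case using point_derivation_const[OF d one x] by simp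
  next
    case (insert i G)
    have "\<delta> (\<lambda>x\<in>X. x i powi e i * (\<Prod>i\<in>G. x i powi e i)) =
        (of_int (e i) * c i + (\<Sum>i\<in>G. of_int (e i) * c i)) * (x i powi e i * (\<Prod>i\<in>G. x i powi e i))"
      using insert
      by (intro point_derivation_multI[where f = "\<lambda>x. x i powi e i"
            and g = "\<lambda>x. \<Prod>i\<in>G. x i powi e i", OF d x pw reg]) auto
    then show ?case using insert by simp
  qed
qed

section \<open>The bracket of Laurent monomials\<close>

definition u_monomial :: "nat \<Rightarrow> (nat \<Rightarrow> int) \<Rightarrow> (nat \<Rightarrow> complex) \<Rightarrow> complex" where
  "u_monomial K e y = (\<Prod>i=1..2*K. ((y i)^2) powi e i)"

text \<open>The pairing of exponent vectors that governs brackets of monomials in the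
  \<open>u_i\<close>. The two squares contribute a factor 4, which cancels the 1/4 of
  \<open>P_matrix\<close>, so the form is integral.\<close>

definition u_form :: "nat \<Rightarrow> (nat \<Rightarrow> int) \<Rightarrow> (nat \<Rightarrow> int) \<Rightarrow> int" where
  "u_form K e f = (\<Sum>i=1..<2*K. e i * f (i+1) - e (i+1) * f i)"

lemma u_monomial_eq: "u_monomial K e y = (\<Prod>i=1..2*K. y i powi (2 * e i))"
  unfolding u_monomial_def by (simp add: power_int_mult)

lemma y_space_nonzero: "y \<in> y_space K \<Longrightarrow> i \<in> {1..2*K} \<Longrightarrow> y i \<noteq> 0"
  unfolding y_space_def partial_torus_def by blast

lemma u_monomial_nonzero: "y \<in> y_space K \<Longrightarrow> u_monomial K e y \<noteq> 0"
  using y_space_nonzero unfolding u_monomial_def by auto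

lemma u_monomial_add:
  assumes "y \<in> y_space K"
  shows "u_monomial K (\<lambda>i. e i + f i) y = u_monomial K e y * u_monomial K f y"
  using y_space_nonzero[OF assms] unfolding u_monomial_def prod.distrib[symmetric]
  by (intro prod.cong refl power_int_add) auto

lemma u_monomial_cong:
  "(\<And>i. i \<in> {1..2*K} \<Longrightarrow> e i = f i) \<Longrightarrow> u_monomial K e y = u_monomial K f y"
  unfolding u_monomial_def by (intro prod.cong) auto

lemma u_form_diff_left: "u_form K (\<lambda>i. e i - e' i) f = u_form K e f - u_form K e' f"
  and u_form_diff_right: "u_form K e (\<lambda>i. f i - f' i) = u_form K e f - u_form K e f'"
  unfolding u_form_def sum_subtractf[symmetric]
  by (intro sum.cong refl; simp add: algebra_simps)+

lemma u_form_scale_left: "u_form K (\<lambda>i. c * e i) f = c * u_form K e f"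
  and u_form_scale_right: "u_form K e (\<lambda>i. c * f i) = c * u_form K e f"
  unfolding u_form_def sum_distrib_left by (intro sum.cong refl; simp add: algebra_simps)+

lemma u_form_self: "u_form K e e = 0"
  unfolding u_form_def by simp

lemma P_matrix_form:
  "(\<Sum>i=1..2*K. \<Sum>j=1..2*K. P_matrix K i j * of_int (2 * e i) * of_int (2 * f j))
    = of_int (u_form K e f)"
proof -
  \<comment> \<open>This treats one off-diagonal; the lower one is reduced to it by exchanging the
    order of summation.\<close>
  have up: "(\<Sum>i=1..n. \<Sum>j=1..n. if j = i + 1 then g i j else 0) = (\<Sum>i=1..<n. g i (i+1))"
    for n and g :: "nat \<Rightarrow> nat \<Rightarrow> complex"
  proof -
    have "(\<Sum>i=1..n. \<Sum>j=1..n. if j = i + 1 then g i j else 0)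
        = (\<Sum>i=1..n. if i + 1 \<le> n then g i (i+1) else 0)"
      by (intro sum.cong refl) (auto simp: sum.delta)
    also have "\<dots> = (\<Sum>i\<in>{1..<n}. g i (i+1))"
      by (intro sum.mono_neutral_cong_right) auto
    finally show ?thesis .
  qed
  let ?n = "2*K"
  have "(\<Sum>i=1..?n. \<Sum>j=1..?n. P_matrix K i j * of_int (2 * e i) * of_int (2 * f j))
      = (\<Sum>i=1..?n. \<Sum>j=1..?n. (if j = i + 1 then of_int (e i * f j) else 0)
          - (if i = j + 1 then of_int (e i * f j) else 0))"
    by (intro sum.cong refl) (auto simp: P_matrix_def)
  also have "\<dots> = (\<Sum>i=1..?n. \<Sum>j=1..?n. if j = i + 1 then of_int (e i * f j) else 0)
      - (\<Sum>j=1..?n. \<Sum>i=1..?n. if i = j + 1 then of_int (e i * f j) else 0)"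
    unfolding sum_subtractf by (rule arg_cong[OF sum.swap])
  also have "\<dots> = (\<Sum>i=1..<?n. of_int (e i * f (i+1))) - (\<Sum>j=1..<?n. of_int (e (j+1) * f j))"
    unfolding up by simp
  also have "\<dots> = of_int (u_form K e f)"
    unfolding u_form_def by (simp add: sum_subtractf)
  finally show ?thesis .
qed

section \<open>Calculus of a fixed bracket on the \<open>y\<close>-space\<close>

locale y_bracket =
  fixes K :: nat
    and B :: "((nat \<Rightarrow> complex) \<Rightarrow> complex) \<Rightarrow> ((nat \<Rightarrow> complex) \<Rightarrow> complex) \<Rightarrow> (nat \<Rightarrow> complex) \<Rightarrow> complex"
  assumes is_bracket: "is_y_bracket K B"
begin

text \<open>\<open>reg\<close> and \<open>br\<close> accept functions without
  \<open>restrict\<close>, so that sums and products can be written pointwise; only values on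
  \<open>y_space K\<close> count.\<close>

definition reg :: "((nat \<Rightarrow> complex) \<Rightarrow> complex) \<Rightarrow> bool" where
  "reg f \<longleftrightarrow> restrict f (y_space K) \<in> y_regular K"

definition br :: "((nat \<Rightarrow> complex) \<Rightarrow> complex) \<Rightarrow> ((nat \<Rightarrow> complex) \<Rightarrow> complex) \<Rightarrow> (nat \<Rightarrow> complex) \<Rightarrow> complex"
  where "br f g = B (restrict f (y_space K)) (restrict g (y_space K))"

lemma reg_const: "reg (\<lambda>y. c)"
  unfolding reg_def y_space_def y_regular_def by (rule regular_functions.const)

lemma reg_coord: "i \<in> {1..2*K} \<Longrightarrow> reg (\<lambda>y. y i)"
  unfolding reg_def y_space_def y_regular_def by (rule regular_functions.coord)

lemma reg_mult: "reg f \<Longrightarrow> reg g \<Longrightarrow> reg (\<lambda>y. f y * g y)"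
  unfolding reg_def y_space_def y_regular_def by (rule regular_multI)

lemma reg_lincomb: "reg f \<Longrightarrow> reg g \<Longrightarrow> reg (\<lambda>y. a * f y + b * g y)"
  unfolding reg_def y_space_def y_regular_def
  using regular_lincomb[of "restrict f (partial_torus {1..2*K} {1..2*K})" "{1..2*K}" "{1..2*K}"
      "restrict g (partial_torus {1..2*K} {1..2*K})" a b]
  by (simp cong: restrict_cong)

lemma reg_add: "reg f \<Longrightarrow> reg g \<Longrightarrow> reg (\<lambda>y. f y + g y)"
  using reg_lincomb[of f g 1 1] by simp

lemma reg_cmult: "reg f \<Longrightarrow> reg (\<lambda>y. c * f y)"
  by (rule reg_mult[OF reg_const])

lemma reg_sum: "finite F \<Longrightarrow> (\<And>k. k \<in> F \<Longrightarrow> reg (h k)) \<Longrightarrow> reg (\<lambda>y. \<Sum>k\<in>F. h k y)"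
  by (induction F rule: finite_induct) (auto intro: reg_const reg_add)

lemma reg_u_monomial: "reg (u_monomial K e)"
  using regular_monomial(1)[of "{1..2*K}" "{1..2*K}" "{1..2*K}" "\<lambda>i. 2 * e i"]
  unfolding reg_def y_space_def y_regular_def u_monomial_eq by simp

lemma reg_cong: "(\<And>y. y \<in> y_space K \<Longrightarrow> f y = g y) \<Longrightarrow> reg f \<longleftrightarrow> reg g"
  unfolding reg_def by (simp cong: restrict_cong)

lemma br_cong:
  "(\<And>y. y \<in> y_space K \<Longrightarrow> f y = f' y) \<Longrightarrow> (\<And>y. y \<in> y_space K \<Longrightarrow> g y = g' y) \<Longrightarrow> br f g = br f' g'"
  unfolding br_def by (simp cong: restrict_cong)

lemma B_skew: "f \<in> y_regular K \<Longrightarrow> g \<in> y_regular K \<Longrightarrow> B g f = (\<lambda>y\<in>y_space K. - B f g y)"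
  using is_bracket unfolding is_y_bracket_def skew_biderivation_def by blast

lemma br_skew: "reg f \<Longrightarrow> reg g \<Longrightarrow> y \<in> y_space K \<Longrightarrow> br g f y = - br f g y"
  unfolding br_def reg_def
  using B_skew[of "restrict f (y_space K)" "restrict g (y_space K)"] by simp

lemma B_point_derivation:
  assumes "h \<in> y_regular K" "y \<in> y_space K"
  shows "point_derivation (y_space K) (y_regular K) y (\<lambda>f. B f h y)"
    and "point_derivation (y_space K) (y_regular K) y (\<lambda>f. B h f y)"
proof -
  have "derivation (y_space K) (y_regular K) (\<lambda>f. B f h)"
    and "derivation (y_space K) (y_regular K) (\<lambda>f. B h f)"
    using is_bracket assms(1) unfolding is_y_bracket_def skew_biderivation_def by blast+
  from this[THEN derivation_at_point, OF assms(2)]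
  show "point_derivation (y_space K) (y_regular K) y (\<lambda>f. B f h y)"
    and "point_derivation (y_space K) (y_regular K) y (\<lambda>f. B h f y)" .
qed

lemma br_lincomb_left:
  assumes "reg f" "reg g" "reg h" "y \<in> y_space K"
  shows "br (\<lambda>y. a * f y + b * g y) h y = a * br f h y + b * br g h y"
proof -
  have "(\<lambda>y\<in>y_space K. a * restrict f (y_space K) y + b * restrict g (y_space K) y)
      = (\<lambda>y\<in>y_space K. a * f y + b * g y)" by (auto intro!: restrict_ext)
  then show ?thesis
    using point_derivation_lincomb[OF B_point_derivation(1)[OF assms(3)[unfolded reg_def] assms(4)]
        assms(1,2)[unfolded reg_def], of a b]
    unfolding br_def by simp
qed

lemma br_add_left:
  "reg f \<Longrightarrow> reg g \<Longrightarrow> reg h \<Longrightarrow> y \<in> y_space K \<Longrightarrow> br (\<lambda>y. f y + g y) h y = br f h y + br g h y"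
  using br_lincomb_left[of f g h y 1 1] by simp

lemma br_cmult_left:
  "reg f \<Longrightarrow> reg h \<Longrightarrow> y \<in> y_space K \<Longrightarrow> br (\<lambda>y. c * f y) h y = c * br f h y"
  using br_lincomb_left[of f f h y c 0] by simp

lemma br_add_right:
  "reg f \<Longrightarrow> reg g \<Longrightarrow> reg h \<Longrightarrow> y \<in> y_space K \<Longrightarrow> br h (\<lambda>y. f y + g y) y = br h f y + br h g y"
  using br_add_left[of f g h y] br_skew[of f h y] br_skew[of g h y] br_skew[of _ h y, OF reg_add[of f g]]
  by simp

lemma br_cmult_right:
  "reg f \<Longrightarrow> reg h \<Longrightarrow> y \<in> y_space K \<Longrightarrow> br h (\<lambda>y. c * f y) y = c * br h f y"
  using br_cmult_left[of f h y c] br_skew[of f h y] br_skew[of _ h y, OF reg_cmult[of f c]] by simp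

lemma br_zero: "reg f \<Longrightarrow> y \<in> y_space K \<Longrightarrow> br f (\<lambda>y. 0) y = 0"
  "reg f \<Longrightarrow> y \<in> y_space K \<Longrightarrow> br (\<lambda>y. 0) f y = 0"
  using br_cmult_right[of f f y 0] br_cmult_left[of f f y 0] by simp_all

lemma br_sum_right:
  "finite F \<Longrightarrow> (\<And>k. k \<in> F \<Longrightarrow> reg (h k)) \<Longrightarrow> reg f \<Longrightarrow> y \<in> y_space K \<Longrightarrow>
    br f (\<lambda>y. \<Sum>k\<in>F. h k y) y = (\<Sum>k\<in>F. br f (h k) y)"
  by (induction F rule: finite_induct) (auto simp: br_zero br_add_right reg_sum)

lemma br_sum_left:
  assumes "finite F" "\<And>k. k \<in> F \<Longrightarrow> reg (h k)" "reg f" "y \<in> y_space K"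
  shows "br (\<lambda>y. \<Sum>k\<in>F. h k y) f y = (\<Sum>k\<in>F. br (h k) f y)"
proof -
  have "br (\<lambda>y. \<Sum>k\<in>F. h k y) f y = - (\<Sum>k\<in>F. br f (h k) y)"
    using br_skew[OF assms(3) reg_sum[OF assms(1,2)] assms(4)] br_sum_right[OF assms] by simp
  also have "\<dots> = (\<Sum>k\<in>F. - br f (h k) y)" by (simp add: sum_negf)
  also have "\<dots> = (\<Sum>k\<in>F. br (h k) f y)"
    by (intro sum.cong refl) (simp add: br_skew[OF assms(3) assms(2) assms(4)])
  finally show ?thesis .
qed

text \<open>\<open>regular_monomial\<close> is applied to each slot in turn, and the logarithmic
  derivatives combine to the double sum of \<open>P_matrix_form\<close>.\<close>

lemma br_u_monomial:
  assumes y: "y \<in> y_space K"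
  shows "br (u_monomial K e) (u_monomial K f) y
    = of_int (u_form K e f) * u_monomial K e y * u_monomial K f y"
proof -
  let ?X = "y_space K" and ?A = "y_regular K" and ?I = "{1..2*K}"
  note mon = regular_monomial(2)[of ?I ?I ?I, folded y_space_def y_regular_def, OF subset_refl _ subset_refl _ y]
  have crd: "(\<lambda>y\<in>?X. y j) \<in> ?A" if "j \<in> ?I" for j using reg_coord[OF that] unfolding reg_def .
  have me: "restrict (u_monomial K e) ?X \<in> ?A" using reg_u_monomial unfolding reg_def .
  have BP: "B (\<lambda>y\<in>?X. y i) (\<lambda>y\<in>?X. y j) y = P_matrix K i j * y i * y j"
    if "i \<in> ?I" "j \<in> ?I" for i j
    using is_bracket that y unfolding is_y_bracket_def by auto
  have 1: "B (restrict (u_monomial K e) ?X) (\<lambda>y\<in>?X. y j) y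
      = (\<Sum>i\<in>?I. of_int (2 * e i) * (P_matrix K i j * y j)) * u_monomial K e y"
    if "j \<in> ?I" for j
    unfolding u_monomial_eq
    by (rule mon[OF _ B_point_derivation(1)[OF crd y]]) (use that BP in auto)
  have "br (u_monomial K e) (u_monomial K f) y
      = (\<Sum>j\<in>?I. of_int (2 * f j) * (\<Sum>i\<in>?I. of_int (2 * e i) * P_matrix K i j) * u_monomial K e y)
        * u_monomial K f y"
    unfolding br_def u_monomial_eq[of K f, abs_def]
  \<comment> \<open>In the second slot the first monomial is fixed and enters the coefficient of
    \<open>y j\<close> as a scalar.\<close>
  proof (subst mon[OF _ B_point_derivation(2)[OF me y]])
    fix j assume "j \<in> ?I"
    then show "B (restrict (u_monomial K e) ?X) (\<lambda>y\<in>?X. y j) y =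
        ((\<Sum>i\<in>?I. of_int (2 * e i) * P_matrix K i j) * u_monomial K e y) * y j"
      unfolding 1[OF \<open>j \<in> ?I\<close>] by (simp add: sum_distrib_left sum_distrib_right algebra_simps)
  qed (simp_all add: mult.assoc)
  also have "(\<Sum>j\<in>?I. of_int (2 * f j) * (\<Sum>i\<in>?I. of_int (2 * e i) * P_matrix K i j) * u_monomial K e y)
      = (\<Sum>j\<in>?I. \<Sum>i\<in>?I. P_matrix K i j * of_int (2 * e i) * of_int (2 * f j)) * u_monomial K e y"
    unfolding sum_distrib_left sum_distrib_right by (intro sum.cong refl) (simp add: algebra_simps)
  also have "\<dots> = of_int (u_form K e f) * u_monomial K e y"
    unfolding P_matrix_form[symmetric] by (subst sum.swap) simp
  finally show ?thesis .
qed

end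

section \<open>The Stokes parameters as sums of Laurent monomials\<close>

definition alternating :: "nat \<Rightarrow> nat \<Rightarrow> int" where
  "alternating n i = (if i \<le> n then (-1)^(n+i+1) else 0)"

definition initial :: "nat \<Rightarrow> nat \<Rightarrow> int" where
  "initial n i = (if i \<le> n then 1 else 0)"

definition evens :: "nat \<Rightarrow> int" where
  "evens i = (if even i then 1 else 0)"

text \<open>Below \<open>j\<close> both vectors alternate in sign, so the two products of a summand
  cancel; beyond \<open>j\<close> the first vector vanishes. Only \<open>i = j\<close>
  contributes.\<close>

lemma u_form_alt_alt:
  assumes "1 \<le> j" "j < l" "l \<le> 2*K"
  shows "u_form K (alternating j) (alternating l) = (-1)^(j+l+1)"
proof -
  have "u_form K (alternating j) (alternating l) = (\<Sum>i=1..<2*K. if i = j then (-1)^(j+l+1) else 0)"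
    unfolding u_form_def using assms
    by (intro sum.cong refl) (auto simp: alternating_def minus_one_power_iff)
  also have "\<dots> = (-1)^(j+l+1)" using assms by simp
  finally show ?thesis .
qed

text \<open>The partial sums oscillate between \<open>(-1)^k\<close> and 0 until
  \<open>i = k\<close> and then stay at \<open>(-1)^k\<close>. The last index \<open>2*K-1\<close>
  is odd, so the value is also right for \<open>k = 2*K\<close>. The next two lemmas follow the same
  scheme.\<close>

lemma u_form_alt_evens:
  assumes "1 \<le> k" "k \<le> 2*K"
  shows "u_form K (alternating k) evens = (-1)^k"
proof -
  have "(\<Sum>i=1..<Suc t. alternating k i * evens (i+1) - alternating k (i+1) * evens i)
      = (if t < k then if odd t then (-1)^k else 0 else (-1)^k)" for t
  proof (induction t)
    case 0
    then show ?case using assms by simp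
  next
    case (Suc t)
    show ?case
      unfolding sum.atLeastLessThan_Suc[of 1 "Suc t", simplified] using Suc
      by (auto simp: alternating_def evens_def minus_one_power_iff not_less less_Suc_eq)
  qed
  from this[of "2*K-1"] show ?thesis using assms unfolding u_form_def by auto
qed

lemma u_form_initial_evens:
  assumes "1 \<le> k" "k \<le> 2*K"
  shows "u_form K (initial k) evens = 1"
proof -
  have "(\<Sum>i=1..<Suc t. initial k i * evens (i+1) - initial k (i+1) * evens i)
      = (if t < k then if odd t then 1 else 0 else 1)" for t
  proof (induction t)
    case 0
    then show ?case using assms by simp
  next
    case (Suc t)
    show ?case
      unfolding sum.atLeastLessThan_Suc[of 1 "Suc t", simplified] using Suc
      by (auto simp: initial_def evens_def not_less less_Suc_eq)
  qed
  from this[of "2*K-1"] show ?thesis using assms unfolding u_form_def by auto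
qed

text \<open>The partial sums oscillate between 0 and \<open>2 * (-1)^k\<close> until the shorter
  vector ends. The summand there moves them to \<open>(-1)^k\<close> if the lengths differ and
  vanishes if \<open>n = k\<close>, which produces the Kronecker delta.\<close>

lemma u_form_alt_initial:
  assumes "1 \<le> k" "k \<le> 2*K" "1 \<le> n" "n \<le> 2*K"
  shows "u_form K (alternating k) (initial n) = (-1)^k + (if n = k then 1 else 0)"
proof -
  have "(\<Sum>i=1..<Suc t. alternating k i * initial n (i+1) - alternating k (i+1) * initial n i)
      = (if t < k \<and> t < n then if odd t then 2 * (-1)^k else 0
         else (-1)^k + (if n = k then 1 else 0))" for t
  proof (induction t)
    case 0
    then show ?case using assms by simp
  next
    case (Suc t)
    show ?case
      unfolding sum.atLeastLessThan_Suc[of 1 "Suc t", simplified] using Suc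
      by (auto simp: alternating_def initial_def minus_one_power_iff not_less less_Suc_eq dest!: le_antisym[OF Suc_leI])
  qed
  from this[of "2*K-1"] show ?thesis using assms unfolding u_form_def
    by (cases "k = 2*K") (auto simp: minus_one_power_iff)
qed

lemma foldr_nested_sum:
  fixes c :: "nat \<Rightarrow> 'a :: comm_semiring_1"
  shows "foldr (\<lambda>j r. 1 + c j * r) [m..<m+k] 1 = (\<Sum>n\<le>k. \<Prod>j=m..<m+n. c j)"
\<comment> \<open>Peeling off the outermost factor of the nested expression shifts the starting
  index, so \<open>m\<close> has to vary.\<close>
proof (induction k arbitrary: m)
  case 0
  then show ?case by simp
next
  case (Suc k)
  have step: "c m * (\<Prod>j=Suc m..<Suc m+n. c j) = (\<Prod>j=m..<m+Suc n. c j)" for n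
    by (subst prod.atLeast_Suc_lessThan[of m]) (auto simp del: prod.op_ivl_Suc)
  have "foldr (\<lambda>j r. 1 + c j * r) [m..<m + Suc k] 1 = 1 + c m * foldr (\<lambda>j r. 1 + c j * r) [Suc m..<Suc m + k] 1"
    by (subst upt_conv_Cons) auto
  also have "\<dots> = 1 + (\<Sum>n\<le>k. c m * (\<Prod>j=Suc m..<Suc m+n. c j))"
    unfolding Suc sum_distrib_left by simp
  also have "\<dots> = (\<Prod>j=m..<m+0. c j) + (\<Sum>n\<le>k. \<Prod>j=m..<m+Suc n. c j)"
    unfolding step by simp
  also have "\<dots> = (\<Sum>n\<le>Suc k. \<Prod>j=m..<m+n. c j)"
    unfolding sum.atMost_Suc_shift by simp
  finally show ?case .
qed

lemma u_monomial_initial: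
  assumes "n \<le> 2*K"
  shows "u_monomial K (initial n) y = (\<Prod>j=1..n. (y j)^2)"
  unfolding u_monomial_def using assms
  by (intro prod.mono_neutral_cong_right) (auto simp: initial_def)

text \<open>The factor \<open>(y 1)^2\<close> completes each product starting at index 2 to a full
  initial product; the range \<open>0..2*K-1\<close> then shifts to \<open>1..2*K\<close>.\<close>

lemma y1_nested:
  assumes "K \<ge> 1"
  shows "(y 1)^2 * nested K y = (\<Sum>n=1..2*K. u_monomial K (initial n) y)"
proof -
  have "nested K y = (\<Sum>n\<le>2*K-1. \<Prod>j=2..<2+n. (y j)^2)"
    unfolding nested_def using foldr_nested_sum[of "\<lambda>j. (y j)^2" 2 "2*K-1"] assms
    by (simp add: Suc_diff_le)
  then have "(y 1)^2 * nested K y = (\<Sum>n\<le>2*K-1. (y 1)^2 * (\<Prod>j=2..<2+n. (y j)^2))"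
    by (simp add: sum_distrib_left)
  also have "\<dots> = (\<Sum>n\<le>2*K-1. \<Prod>j=1..Suc n. (y j)^2)"
    by (intro sum.cong refl)
      (simp add: prod.atLeast_Suc_atMost numeral_2_eq_2 atLeastLessThanSuc_atLeastAtMost)
  also have "\<dots> = (\<Sum>n=1..2*K. \<Prod>j=1..n. (y j)^2)"
    using assms by (intro sum.reindex_bij_witness[of _ "\<lambda>n. n - 1" Suc]) auto
  also have "\<dots> = (\<Sum>n=1..2*K. u_monomial K (initial n) y)"
    by (intro sum.cong refl) (simp add: u_monomial_initial)
  finally show ?thesis .
qed

lemma u_monomial_evens: "u_monomial K (\<lambda>i. c * evens i) y = (\<Prod>j=1..K. ((y (2*j))^2) powi c)"
  unfolding u_monomial_def by (induction K) (simp_all add: evens_def)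

lemma monodromy_eq: "monodromy K y = u_monomial K evens y"
  using u_monomial_evens[of K 1 y] unfolding monodromy_def by simp

lemma u_monomial_alt:
  assumes "n \<le> 2*K"
  shows "u_monomial K (\<lambda>i. c * alternating n i) y = (\<Prod>j=1..n. y j powi (2 * (c * (-1)^(n+j+1))))"
  unfolding u_monomial_eq using assms
  by (intro prod.mono_neutral_cong_right) (auto simp: alternating_def)

text \<open>The last exponent of \<open>a_n\<close> is always -1, so multiplying by
  \<open>u_n\<close> removes that variable and leaves \<open>1/a_(n-1)\<close>.\<close>

lemma u_monomial_alt_step:
  assumes "y \<in> y_space K" "1 \<le> n" "n \<le> 2*K"
  shows "u_monomial K (alternating n) y * (y n)^2 = u_monomial K (\<lambda>i. - alternating (n - 1) i) y"
proof -
  have "(y n)^2 = u_monomial K (\<lambda>i. if i = n then 1 else 0) y"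
    using assms unfolding u_monomial_def
    by (simp add: if_distrib[of "\<lambda>e. _ powi e"] prod.delta cong: if_cong)
  then have "u_monomial K (alternating n) y * (y n)^2 = u_monomial K (\<lambda>i. alternating n i + (if i = n then 1 else 0)) y"
    using assms(1) by (simp add: u_monomial_add)
  also have "\<dots> = u_monomial K (\<lambda>i. - alternating (n - 1) i) y"
    by (rule u_monomial_cong) (use assms in \<open>auto simp: alternating_def minus_one_power_iff\<close>)
  finally show ?thesis .
qed

text \<open>
  These are \<open>a\<^sub>n\<close> for \<open>c = 1\<close> and \<open>1/a\<^sub>n\<close> for \<open>c = -1\<close>.  The value \<open>0\<close> outside \<open>1..2K\<close> is what
  makes \<open>s\<^sub>1\<close> and the Stokes parameter of index \<open>2K+1\<close> instances of the general formula.
\<close>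

definition alt_monomial :: "nat \<Rightarrow> int \<Rightarrow> nat \<Rightarrow> (nat \<Rightarrow> complex) \<Rightarrow> complex" where
  "alt_monomial K c n = (\<lambda>y. if n \<in> {1..2*K} then u_monomial K (\<lambda>i. c * alternating n i) y else 0)"

text \<open>This is \<open>w_n\<close>: the exponents \<open>2 * evens\<close> account for the
  square of the monodromy in the denominator.\<close>

definition tail_monomial :: "nat \<Rightarrow> nat \<Rightarrow> (nat \<Rightarrow> complex) \<Rightarrow> complex" where
  "tail_monomial K n = u_monomial K (\<lambda>i. initial n i - 2 * evens i)"

lemma alt_monomial_inverse:
  assumes "y \<in> y_space K" "n \<in> {1..2*K}"
  shows "alt_monomial K 1 n y * alt_monomial K (-1) n y = 1"
proof -
  have "alt_monomial K 1 n y * alt_monomial K (-1) n y = u_monomial K (\<lambda>i. 1 * alternating n i + -1 * alternating n i) y"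
    using assms unfolding alt_monomial_def by (simp only: u_monomial_add if_True)
  then show ?thesis by (simp add: u_monomial_def)
qed

text \<open>Expanding \<open>1 + (y n)^2\<close> gives \<open>a_n\<close> and, by
  \<open>u_monomial_alt_step\<close>, \<open>1/a_(n-1)\<close>. At the two ends one term is missing,
  which the zero values of \<open>alt_monomial\<close> reproduce.\<close>

lemma stokes_eq:
  assumes y: "y \<in> y_space K" and K: "K \<ge> 1" and n: "1 \<le> n" "n \<le> 2*K+1"
  shows "stokes K y n = (-1)^n * (alt_monomial K 1 n y + alt_monomial K (-1) (n-1) y)"
proof -
  consider "n = 2*K+1" | "n = 1" | "1 < n" "n \<le> 2*K" using n by linarith
  then show ?thesis
  proof cases
    case 1
    then show ?thesis
      using K u_monomial_alt[of "2*K" K "-1" y] by (simp add: stokes_def alt_monomial_def power_add)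
  next
    case 2
    then show ?thesis
      using K u_monomial_alt[of 1 K 1 y] by (simp add: stokes_def alt_monomial_def)
  next
    case 3
    \<comment> \<open>The signs depend on \<open>n\<close> only through its parity, which matches
      the two general branches of \<open>stokes\<close>.\<close>
    have sgn: "(-1::int)^(n+j+1) = (if even n then (-1)^(j+1) else (-1)^j)" for j
      by (simp add: minus_one_power_iff)
    have "u_monomial K (alternating n) y = (\<Prod>j=1..n. y j powi (2 * (if even n then (-1)^(j+1) else (-1)^j)))"
      using u_monomial_alt[of n K 1 y] 3 unfolding sgn by simp
    then have "stokes K y n = (-1)^n * ((1 + (y n)^2) * u_monomial K (alternating n) y)"
      using 3 by (cases "even n") (simp_all add: stokes_def algebra_simps)
    also have "(1 + (y n)^2) * u_monomial K (alternating n) y = u_monomial K (alternating n) y + u_monomial K (alternating n) y * (y n)^2"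
      by (simp add: algebra_simps)
    also have "u_monomial K (alternating n) y * (y n)^2 = u_monomial K (\<lambda>i. - alternating (n-1) i) y"
      by (rule u_monomial_alt_step) (use y 3 in auto)
    finally have "stokes K y n = (-1)^n * (u_monomial K (alternating n) y + u_monomial K (\<lambda>i. - alternating (n-1) i) y)" .
    moreover have "n - 1 \<in> {1..2*K}" using 3 by auto
    ultimately show ?thesis using 3 by (simp add: alt_monomial_def)
  qed
qed

lemma stokes_last_eq:
  assumes y: "y \<in> y_space K" and K: "K \<ge> 1"
  shows "stokes K y (2*K+2) = (\<Sum>n=1..2*K. tail_monomial K n y)"
proof -
  have pw: "y (2*j) powi (-4) = ((y (2*j))^2) powi (-2)" for j
    using power_int_mult[of "y (2*j)" 2 "-2"] by simp
  have "stokes K y (2*K+2) = ((y 1)^2 * nested K y) * u_monomial K (\<lambda>i. -2 * evens i) y"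
    unfolding u_monomial_evens stokes_def pw using K by simp
  also have "\<dots> = (\<Sum>n=1..2*K. tail_monomial K n y)"
    unfolding y1_nested[OF K] sum_distrib_right tail_monomial_def u_monomial_add[OF y, symmetric]
    by simp
  finally show ?thesis .
qed

text \<open>Move the factor \<open>u_n\<close> from \<open>w_n = u_n w_(n-1)\<close> to
  \<open>a_n\<close>, which turns \<open>a_n\<close> into \<open>1/a_(n-1)\<close>.\<close>

lemma alt_tail_step:
  assumes y: "y \<in> y_space K" and n: "2 \<le> n" "n \<le> 2*K"
  shows "alt_monomial K 1 n y * tail_monomial K n y
    = alt_monomial K (-1) (n-1) y * tail_monomial K (n-1) y"
proof -
  have n': "n - 1 \<in> {1..2*K}" using n by auto
  have "alt_monomial K 1 n y * tail_monomial K n y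
      = u_monomial K (\<lambda>i. 1 * alternating n i + (initial n i - 2 * evens i)) y"
    unfolding alt_monomial_def tail_monomial_def u_monomial_add[OF y] using n by simp
  also have "\<dots> = u_monomial K (\<lambda>i. -1 * alternating (n-1) i + (initial (n-1) i - 2 * evens i)) y"
    by (rule u_monomial_cong)
      (use n in \<open>cases n; auto simp: alternating_def initial_def minus_one_power_iff le_Suc_eq\<close>)
  also have "\<dots> = alt_monomial K (-1) (n-1) y * tail_monomial K (n-1) y"
    unfolding alt_monomial_def tail_monomial_def u_monomial_add[OF y] using n'
    by (simp only: if_True)
  finally show ?thesis .
qed

text \<open>Since \<open>a_1 = 1/u_1\<close>, the numerator of \<open>w_1\<close> cancels. This is
  the source of the term with the inverse square of \<open>Lam\<close> in
  \<open>FN_ss\<close>.\<close>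

lemma alt_tail_first:
  assumes y: "y \<in> y_space K" and K: "K \<ge> 1"
  shows "alt_monomial K 1 1 y * tail_monomial K 1 y = 1 / (monodromy K y)^2"
proof -
  have "alt_monomial K 1 1 y * tail_monomial K 1 y * (monodromy K y * monodromy K y)
      = u_monomial K (\<lambda>i. 1 * alternating 1 i + (initial 1 i - 2 * evens i) + (evens i + evens i)) y"
    unfolding alt_monomial_def tail_monomial_def monodromy_eq u_monomial_add[OF y] using K by simp
  also have "\<dots> = u_monomial K (\<lambda>i. 0) y"
    by (rule u_monomial_cong) (auto simp: alternating_def initial_def)
  finally show ?thesis
    using u_monomial_nonzero[OF y, of evens]
    by (simp add: u_monomial_def[of _ "\<lambda>i. 0"] monodromy_eq power2_eq_square divide_simps)
qed

text \<open>The exponents \<open>(-1)^i\<close> of \<open>1/a_(2K)\<close> and 1 of the full product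
  add up to 2 at even and 0 at odd \<open>i\<close>, which is exactly the squared monodromy.\<close>

lemma alt_tail_last:
  assumes y: "y \<in> y_space K" and K: "K \<ge> 1"
  shows "alt_monomial K (-1) (2*K) y * tail_monomial K (2*K) y = 1"
proof -
  have "alt_monomial K (-1) (2*K) y * tail_monomial K (2*K) y
      = u_monomial K (\<lambda>i. -1 * alternating (2*K) i + (initial (2*K) i - 2 * evens i)) y"
    unfolding alt_monomial_def tail_monomial_def u_monomial_add[OF y] using K by simp
  also have "\<dots> = u_monomial K (\<lambda>i. 0) y"
    by (rule u_monomial_cong) (auto simp: alternating_def initial_def evens_def minus_one_power_iff)
  finally show ?thesis by (simp add: u_monomial_def)
qed

section \<open>Brackets of the monomials and of the sums forming the Stokes parameters\<close>

context y_bracket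
begin

lemma reg_alt_monomial: "reg (alt_monomial K c n)"
  by (cases "n \<in> {1..2*K}") (simp_all only: alt_monomial_def if_True if_False reg_const reg_u_monomial)

lemma reg_tail_monomial: "reg (tail_monomial K n)"
  unfolding tail_monomial_def by (rule reg_u_monomial)

lemma reg_monodromy: "reg (monodromy K)"
  using reg_u_monomial by (simp add: monodromy_eq[abs_def])

text \<open>The form is bilinear in the exponents, hence the factor \<open>c * d\<close>. An index
  outside \<open>1..2*K\<close> makes both sides zero, so later expansions need no boundary
  cases.\<close>

lemma br_alt_alt:
  assumes y: "y \<in> y_space K" and jl: "j < l"
  shows "br (alt_monomial K c j) (alt_monomial K d l) y
    = of_int (c * d) * (-1)^(j+l+1) * alt_monomial K c j y * alt_monomial K d l y"
proof (cases "j \<in> {1..2*K} \<and> l \<in> {1..2*K}")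
  case True
  then have "u_form K (alternating j) (alternating l) = (-1)^(j+l+1)" using jl by (intro u_form_alt_alt) auto
  then show ?thesis
    using True br_u_monomial[OF y]
    by (simp add: alt_monomial_def u_form_scale_left u_form_scale_right)
next
  case False
  then have "alt_monomial K c j = (\<lambda>y. 0) \<or> alt_monomial K d l = (\<lambda>y. 0)"
    by (auto simp: alt_monomial_def)
  then show ?thesis using br_zero[OF reg_alt_monomial y] by auto
qed

text \<open>Powers of one monomial commute. With \<open>c = 1\<close> and \<open>d = -1\<close> this
  exception to the sign pattern creates the constant 1 for neighbouring Stokes parameters.\<close>

lemma br_alt_same:
  assumes y: "y \<in> y_space K"
  shows "br (alt_monomial K c n) (alt_monomial K d n) y = 0"
proof (cases "n \<in> {1..2*K}")
  case True
  then show ?thesis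
    using br_u_monomial[OF y]
    by (simp add: alt_monomial_def u_form_scale_left u_form_scale_right u_form_self)
next
  case False
  then have "alt_monomial K c n = (\<lambda>y. 0)" by (auto simp: alt_monomial_def)
  then show ?thesis using br_zero[OF reg_alt_monomial y] by auto
qed

lemma br_alt_monodromy:
  assumes y: "y \<in> y_space K"
  shows "br (alt_monomial K c n) (monodromy K) y
    = of_int c * (-1)^n * alt_monomial K c n y * monodromy K y"
proof (cases "n \<in> {1..2*K}")
  case True
  then have "u_form K (alternating n) evens = (-1)^n" by (intro u_form_alt_evens) auto
  then show ?thesis
    using True br_u_monomial[OF y]
    by (simp add: alt_monomial_def monodromy_eq[abs_def] u_form_scale_left)
next
  case False
  then have "alt_monomial K c n = (\<lambda>y. 0)" by (auto simp: alt_monomial_def)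
  then show ?thesis using br_zero[OF reg_monodromy y] by auto
qed

text \<open>The monodromy commutes with its own powers, so only \<open>u_1 ... u_n\<close>
  contributes.\<close>

lemma br_tail_monodromy:
  assumes y: "y \<in> y_space K" and n: "n \<in> {1..2*K}"
  shows "br (tail_monomial K n) (monodromy K) y = tail_monomial K n y * monodromy K y"
proof -
  have "u_form K (\<lambda>i. initial n i - 2 * evens i) evens = 1"
    using n by (simp add: u_form_diff_left u_form_scale_left u_form_self u_form_initial_evens)
  then show ?thesis
    using br_u_monomial[OF y] by (simp add: tail_monomial_def monodromy_eq[abs_def])
qed

text \<open>The denominator of \<open>w_n\<close> contributes \<open>-2 * (-1)^k\<close>, which
  flips the sign of the term \<open>(-1)^k\<close> from \<open>u_form_alt_initial\<close> and leaves
  the delta alone.\<close>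

lemma br_alt_tail:
  assumes y: "y \<in> y_space K" and k: "k \<in> {1..2*K}" and n: "n \<in> {1..2*K}"
  shows "br (alt_monomial K c k) (tail_monomial K n) y
    = of_int c * ((-1)^(k+1) + (if n = k then 1 else 0)) * alt_monomial K c k y * tail_monomial K n y"
proof -
  have "u_form K (alternating k) (\<lambda>i. initial n i - 2 * evens i) = (-1)^(k+1) + (if n = k then 1 else 0)"
    using k n by (simp add: u_form_diff_right u_form_scale_right u_form_alt_initial u_form_alt_evens)
  then show ?thesis
    using k br_u_monomial[OF y]
    by (simp add: alt_monomial_def tail_monomial_def u_form_scale_left)
qed

lemma br_alt_tail_sum:
  assumes y: "y \<in> y_space K"
  shows "br (alt_monomial K c k) (\<lambda>y. \<Sum>n=1..2*K. tail_monomial K n y) y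
    = of_int c * alt_monomial K c k y *
      ((-1)^(k+1) * (\<Sum>n=1..2*K. tail_monomial K n y) + tail_monomial K k y)"
proof (cases "k \<in> {1..2*K}")
  case True
  have "br (alt_monomial K c k) (\<lambda>y. \<Sum>n=1..2*K. tail_monomial K n y) y
      = (\<Sum>n=1..2*K. br (alt_monomial K c k) (tail_monomial K n) y)"
    by (rule br_sum_right[OF _ _ reg_alt_monomial y]) (auto intro: reg_tail_monomial)
  also have "\<dots> = (\<Sum>n=1..2*K. of_int c * alt_monomial K c k y *
      ((-1)^(k+1) * tail_monomial K n y + (if n = k then tail_monomial K n y else 0)))"
    by (intro sum.cong refl) (simp add: br_alt_tail[OF y True] algebra_simps)
  also have "\<dots> = of_int c * alt_monomial K c k y *
      (\<Sum>n=1..2*K. (-1)^(k+1) * tail_monomial K n y + (if n = k then tail_monomial K n y else 0))"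
    unfolding sum_distrib_left ..
  also have "(\<Sum>n=1..2*K. (-1)^(k+1) * tail_monomial K n y + (if n = k then tail_monomial K n y else 0))
      = (-1)^(k+1) * (\<Sum>n=1..2*K. tail_monomial K n y) + tail_monomial K k y"
    using True by (simp only: sum.distrib sum_distrib_left[symmetric] sum.delta finite_atLeastAtMost if_True)
  finally show ?thesis .
next
  case False
  then have "alt_monomial K c k = (\<lambda>y. 0)" by (auto simp: alt_monomial_def)
  moreover have "reg (\<lambda>y. \<Sum>n=1..2*K. tail_monomial K n y)"
    by (intro reg_sum reg_tail_monomial) simp
  ultimately show ?thesis using br_zero(2) y by simp
qed

text \<open>The two-term expression of \<open>stokes_eq\<close>, as a function to which bilinearity
  of \<open>br\<close> applies directly.\<close>

definition stokes_form :: "nat \<Rightarrow> (nat \<Rightarrow> complex) \<Rightarrow> complex" where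
  "stokes_form n = (\<lambda>y. (-1)^n * (alt_monomial K 1 n y + alt_monomial K (-1) (n-1) y))"

lemma reg_stokes_form: "reg (stokes_form n)"
  unfolding stokes_form_def by (intro reg_cmult reg_add reg_alt_monomial)

lemma br_stokes_form_left:
  "reg h \<Longrightarrow> y \<in> y_space K \<Longrightarrow>
    br (stokes_form n) h y = (-1)^n * (br (alt_monomial K 1 n) h y + br (alt_monomial K (-1) (n-1)) h y)"
  unfolding stokes_form_def by (simp add: br_cmult_left br_add_left reg_add reg_alt_monomial)

lemma br_stokes_form_right:
  "reg h \<Longrightarrow> y \<in> y_space K \<Longrightarrow>
    br h (stokes_form n) y = (-1)^n * (br h (alt_monomial K 1 n) y + br h (alt_monomial K (-1) (n-1)) y)"
  unfolding stokes_form_def by (simp add: br_cmult_right br_add_right reg_add reg_alt_monomial)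

text \<open>Bilinearity gives four brackets. Lowering an index and inverting the monomial both flip
  the sign, so all four carry the same sign, apart from the pair \<open>a_j\<close>,
  \<open>1/a_(l-1)\<close> when \<open>l = j + 1\<close>.\<close>

lemma br_stokes_form:
  assumes y: "y \<in> y_space K" and jl: "1 \<le> j" "j < l" "l \<le> 2*K+1"
  shows "br (stokes_form j) (stokes_form l) y = (if l = Suc j then 1 else 0) + (-1)^(j+l+1) * stokes_form j y * stokes_form l y"
proof -
  obtain i m where i: "j = Suc i" "l = Suc m" "i < m"
    using jl by (metis Suc_le_D Suc_less_eq One_nat_def less_imp_Suc_add)
  note eq = br_stokes_form_left[OF reg_stokes_form y] br_stokes_form_right[OF reg_alt_monomial y]
  show ?thesis
  proof (cases "m = j")
    case True
    \<comment> \<open>This pair has bracket 0 but product 1 inside the product of the two Stokes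
      parameters; the correction restores the difference.\<close>
    have inv: "alt_monomial K 1 (Suc i) y * alt_monomial K (-1) (Suc i) y = 1"
      by (rule alt_monomial_inverse[OF y]) (use i jl True in auto)
    have "br (stokes_form j) (stokes_form l) y = 1 + stokes_form j y * stokes_form l y"
      using i True inv unfolding eq
      by (simp add: br_alt_alt[OF y] br_alt_same[OF y] stokes_form_def minus_one_power_iff algebra_simps)
    then show ?thesis using i True by simp
  next
    case False
    then show ?thesis
      using i unfolding eq
      by (simp add: br_alt_alt[OF y] stokes_form_def minus_one_power_iff algebra_simps)
  qed
qed

text \<open>Both terms \<open>a_n\<close> and \<open>1/a_(n-1)\<close> have the same weight
  \<open>(-1)^n\<close> against the monodromy.\<close>

lemma br_stokes_form_monodromy:
  assumes y: "y \<in> y_space K" and n: "1 \<le> n"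
  shows "br (stokes_form n) (monodromy K) y = (-1)^n * stokes_form n y * monodromy K y"
proof -
  obtain i where "n = Suc i" using n by (cases n) auto
  then show ?thesis
    unfolding br_stokes_form_left[OF reg_monodromy y] br_alt_monodromy[OF y]
    by (simp add: stokes_form_def minus_one_power_iff algebra_simps)
qed

lemma br_stokes_form_tail_sum:
  assumes y: "y \<in> y_space K" and K: "K \<ge> 1" and n: "1 \<le> n" "n \<le> 2*K+1"
  shows "br (stokes_form n) (\<lambda>y. \<Sum>n=1..2*K. tail_monomial K n y) y
    = (if n = 2*K+1 then 1 else 0) - (if n = 1 then 1 else 0) / (monodromy K y)^2
      + (-1)^(n+1) * stokes_form n y * (\<Sum>n=1..2*K. tail_monomial K n y)"
proof -
  obtain i where i: "n = Suc i" using n by (cases n) auto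
  let ?W = "\<Sum>n=1..2*K. tail_monomial K n y"
  have reg_W: "reg (\<lambda>y. \<Sum>n=1..2*K. tail_monomial K n y)"
    by (intro reg_sum reg_tail_monomial) simp
  have "br (stokes_form n) (\<lambda>y. \<Sum>n=1..2*K. tail_monomial K n y) y
      = (-1)^(n+1) * stokes_form n y * ?W + (-1)^n * (alt_monomial K 1 n y * tail_monomial K n y
          - alt_monomial K (-1) (n-1) y * tail_monomial K (n-1) y)"
    using i unfolding br_stokes_form_left[OF reg_W y] br_alt_tail_sum[OF y]
    by (simp add: stokes_form_def minus_one_power_iff algebra_simps)
  \<comment> \<open>The delta terms cancel by \<open>alt_tail_step\<close> in the interior; at each
    end one of the two is zero and the other survives.\<close>
  moreover have "(-1)^n * (alt_monomial K 1 n y * tail_monomial K n y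
          - alt_monomial K (-1) (n-1) y * tail_monomial K (n-1) y)
      = (if n = 2*K+1 then 1 else 0) - (if n = 1 then 1 else 0) / (monodromy K y)^2"
  proof -
    consider "n = 2*K+1" | "n = 1" | "2 \<le> n" "n \<le> 2*K" using n by linarith
    then show ?thesis
    proof cases
      case 1
      then have "alt_monomial K 1 n y = 0" by (simp add: alt_monomial_def)
      then show ?thesis using 1 K alt_tail_last[OF y K] by simp
    next
      case 2
      then have "alt_monomial K (-1) (n-1) y = 0" by (simp add: alt_monomial_def)
      then show ?thesis using 2 K alt_tail_first[OF y K] by simp
    next
      case 3
      then show ?thesis using alt_tail_step[OF y 3] by simp
    qed
  qed
  ultimately show ?thesis by simp
qed

end

section \<open>Pulling back the Flaschka--Newell bracket\<close>

lemma FN_ss_param: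
  assumes "j \<in> {1..2*K+2}" "l \<in> {1..2*K+2}" "j < l"
  shows "FN_ss K j l (param K y) = (if l = Suc j then 1 else 0)
    - (if j = 1 \<and> l = 2*K+2 then 1 else 0) / (monodromy K y)^2
    + (-1)^(j+l+1) * stokes K y j * stokes K y l"
proof -
  \<comment> \<open>A power of -1 sees only the parity, so the integer exponent may be replaced by a
    natural one.\<close>
  have "even (int j - int l + 1) \<longleftrightarrow> even (j+l+1)" by simp
  then have "(-1 :: complex) powi (int j - int l + 1) = (-1)^(j+l+1)"
    by (simp add: power_int_minus_left minus_one_power_iff)
  then show ?thesis using assms by (auto simp: FN_ss_def param_def FN_coords_def)
qed

lemma FN_sl_param:
  "j \<in> {1..2*K+2} \<Longrightarrow> FN_sl j (param K y) = (-1)^j * stokes K y j * monodromy K y"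
  by (simp add: FN_sl_def param_def FN_coords_def)

lemma param_in_FN_space:
  assumes "y \<in> y_space K"
  shows "param K y \<in> FN_space K"
  using u_monomial_nonzero[OF assms, of evens]
  by (simp add: FN_space_def partial_torus_def param_def FN_coords_def monodromy_eq)

context y_bracket
begin

lemma B_regular:
  assumes "f \<in> y_regular K" "g \<in> y_regular K"
  shows "B f g \<in> y_regular K"
proof -
  have "B \<in> y_regular K \<rightarrow>\<^sub>E (y_regular K \<rightarrow>\<^sub>E y_regular K)"
    using is_bracket unfolding is_y_bracket_def skew_biderivation_def by (elim conjE)
  from PiE_mem[OF PiE_mem[OF this assms(1)] assms(2)] show ?thesis .
qed

lemma stokes_eq_stokes_form:
  "K \<ge> 1 \<Longrightarrow> y \<in> y_space K \<Longrightarrow> n \<in> {1..2*K+1} \<Longrightarrow> stokes K y n = stokes_form n y"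
  by (simp add: stokes_form_def stokes_eq)

lemma reg_stokes:
  assumes K: "K \<ge> 1" and n: "n \<in> {1..2*K+2}"
  shows "reg (\<lambda>y. stokes K y n)"
proof (cases "n = 2*K+2")
  case True
  have "reg (\<lambda>y. \<Sum>n=1..2*K. tail_monomial K n y)"
    by (intro reg_sum reg_tail_monomial) simp
  then show ?thesis using True stokes_last_eq[OF _ K] by (simp cong: reg_cong)
next
  case False
  then have "n \<in> {1..2*K+1}" using n by auto
  then show ?thesis using reg_stokes_form[of n] stokes_eq_stokes_form[OF K] by (simp cong: reg_cong)
qed

text \<open>The last Stokes parameter is the sum of the \<open>w_n\<close> and needs its own case.
  There \<open>l\<close> is even, so \<open>(-1)^(j+1)\<close> is the required sign, and
  \<open>j = 2*K+1\<close> is the neighbour case.\<close>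

lemma br_stokes_stokes:
  assumes K: "K \<ge> 1" and j: "j \<in> {1..2*K+2}" and l: "l \<in> {1..2*K+2}" and jl: "j < l"
    and y: "y \<in> y_space K"
  shows "br (\<lambda>y. stokes K y j) (\<lambda>y. stokes K y l) y = FN_ss K j l (param K y)"
proof (cases "l = 2*K+2")
  case True
  have "br (\<lambda>y. stokes K y j) (\<lambda>y. stokes K y l) = br (stokes_form j) (\<lambda>y. \<Sum>n=1..2*K. tail_monomial K n y)"
    using True jl j K stokes_last_eq by (intro br_cong) (auto simp: stokes_eq_stokes_form)
  then show ?thesis
    using True jl j K stokes_last_eq[OF y K] stokes_eq_stokes_form[OF K y, of j]
    by (simp add: br_stokes_form_tail_sum[OF y, simplified] FN_ss_param minus_one_power_iff)
next
  case False
  have "br (\<lambda>y. stokes K y j) (\<lambda>y. stokes K y l) = br (stokes_form j) (stokes_form l)"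
    using False jl j l K by (intro br_cong) (auto simp: stokes_eq_stokes_form)
  then show ?thesis
    using False jl j l K y by (simp add: br_stokes_form FN_ss_param stokes_eq_stokes_form)
qed

lemma br_stokes_monodromy:
  assumes K: "K \<ge> 1" and j: "j \<in> {1..2*K+2}" and y: "y \<in> y_space K"
  shows "br (\<lambda>y. stokes K y j) (monodromy K) y = FN_sl j (param K y)"
proof (cases "j = 2*K+2")
  case True
  have "br (\<lambda>y. stokes K y j) (monodromy K) = br (\<lambda>y. \<Sum>n=1..2*K. tail_monomial K n y) (monodromy K)"
    using True K stokes_last_eq by (intro br_cong) auto
  then have "br (\<lambda>y. stokes K y j) (monodromy K) y
      = br (\<lambda>y. \<Sum>n=1..2*K. tail_monomial K n y) (monodromy K) y" by simp
  also have "\<dots> = (\<Sum>n=1..2*K. br (tail_monomial K n) (monodromy K) y)"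
    by (intro br_sum_left reg_tail_monomial reg_monodromy y) simp
  also have "\<dots> = (\<Sum>n=1..2*K. tail_monomial K n y) * monodromy K y"
    unfolding sum_distrib_right by (intro sum.cong refl br_tail_monodromy[OF y])
  finally show ?thesis
    using True j stokes_last_eq[OF y K] by (simp add: FN_sl_param)
next
  case False
  have "br (\<lambda>y. stokes K y j) (monodromy K) = br (stokes_form j) (monodromy K)"
    using False j K by (intro br_cong) (auto simp: stokes_eq_stokes_form)
  then show ?thesis
    using False j K y by (simp add: br_stokes_form_monodromy FN_sl_param stokes_eq_stokes_form)
qed

section \<open>From coordinates to all regular functions\<close>

lemma reg_param_coord:
  assumes "K \<ge> 1" "c \<in> FN_coords K"
  shows "reg (\<lambda>y. param K y c)"
  using assms reg_stokes reg_monodromy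
  by (cases c) (auto simp: param_def FN_coords_def)

text \<open>The inverse of \<open>Lam\<close> is a generator of \<open>FN_regular K\<close>; its
  pullback is regular because the monodromy is a monomial.\<close>

lemma reg_inverse_monodromy: "reg (\<lambda>y. inverse (monodromy K y))"
proof -
  have "u_monomial K (\<lambda>i. - evens i) y = inverse (monodromy K y)" for y
    unfolding monodromy_eq u_monomial_def by (simp add: power_int_minus prod_inversef[symmetric] comp_def)
  then show ?thesis using reg_u_monomial[of "\<lambda>i. - evens i"] by (simp add: fun_eq_iff cong: reg_cong)
qed

lemma pullback_regular:
  assumes K: "K \<ge> 1" and f: "f \<in> FN_regular K"
  shows "pullback K f \<in> y_regular K"
proof -
  have "reg (\<lambda>y. f (param K y))"
    using f unfolding FN_regular_def
  proof (induction rule: regular_functions.induct)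
    case (const c)
    then show ?case
      using reg_const[of c] by (simp add: param_in_FN_space[unfolded FN_space_def] cong: reg_cong)
  next
    case (coord i)
    then show ?case
      using reg_param_coord[OF K] by (simp add: param_in_FN_space[unfolded FN_space_def] cong: reg_cong)
  next
    case (coord_inverse i)
    moreover have "param K y Lam = monodromy K y" for y
      by (simp add: param_def FN_coords_def)
    ultimately show ?case
      using reg_inverse_monodromy
      by (simp add: param_in_FN_space[unfolded FN_space_def] cong: reg_cong)
  next
    case (add f g)
    then show ?case
      using reg_add[OF add.IH] by (simp add: param_in_FN_space[unfolded FN_space_def] cong: reg_cong)
  next
    case (mult f g)
    then show ?case
      using reg_mult[OF mult.IH] by (simp add: param_in_FN_space[unfolded FN_space_def] cong: reg_cong)
  qed
  then show ?thesis unfolding reg_def pullback_def .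
qed

lemma pullback_coord: "pullback K (\<lambda>x\<in>FN_space K. x c) = (\<lambda>y\<in>y_space K. param K y c)"
  unfolding pullback_def by (auto intro!: restrict_ext simp: param_in_FN_space)

text \<open>\<open>pullback K\<close> respects linear combinations and products, and evaluating a
  pullback at \<open>y\<close> is evaluation at \<open>param K y\<close>.\<close>

lemma pullback_point_derivation:
  assumes K: "K \<ge> 1" and y: "y \<in> y_space K"
    and d: "point_derivation (y_space K) (y_regular K) y \<delta>"
  shows "point_derivation (FN_space K) (FN_regular K) (param K y) (\<lambda>f. \<delta> (pullback K f))"
proof -
  have lin: "pullback K (\<lambda>x\<in>FN_space K. a * f x + b * g x)
      = (\<lambda>y\<in>y_space K. a * pullback K f y + b * pullback K g y)" for a b f g
    unfolding pullback_def by (auto intro!: restrict_ext simp: param_in_FN_space)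
  have mul: "pullback K (\<lambda>x\<in>FN_space K. f x * g x)
      = (\<lambda>y\<in>y_space K. pullback K f y * pullback K g y)" for f g
    unfolding pullback_def by (auto intro!: restrict_ext simp: param_in_FN_space)
  have at: "pullback K f y = f (param K y)" for f
    using y by (simp add: pullback_def)
  show ?thesis
    unfolding point_derivation_def lin mul
    using point_derivation_lincomb[OF d pullback_regular[OF K] pullback_regular[OF K]]
      point_derivation_mult[OF d pullback_regular[OF K] pullback_regular[OF K]]
    by (simp add: at)
qed

text \<open>Both sides are skew, so it suffices to treat \<open>S j\<close> before
  \<open>S l\<close> for \<open>j < l\<close> and \<open>S j\<close> before \<open>Lam\<close>; on
  the diagonal both sides are their own negatives and vanish.\<close>

lemma pullback_bracket_coord:
  assumes K: "K \<ge> 1" and FN: "is_FN_bracket K B'" and y: "y \<in> y_space K"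
    and c: "c \<in> FN_coords K" and d: "d \<in> FN_coords K"
  shows "br (\<lambda>y. param K y c) (\<lambda>y. param K y d) y
    = B' (\<lambda>x\<in>FN_space K. x c) (\<lambda>x\<in>FN_space K. x d) (param K y)"
proof -
  let ?p = "param K y" and ?x = "\<lambda>c. \<lambda>x\<in>FN_space K. x c :: complex"
  let ?br = "\<lambda>c d. br (\<lambda>y. param K y c) (\<lambda>y. param K y d) y"
  note p = param_in_FN_space[OF y]
  have sk: "?br d c = - ?br c d" if "c \<in> FN_coords K" "d \<in> FN_coords K" for c d
    using br_skew reg_param_coord K y that by blast
  have sk': "B' (?x d) (?x c) ?p = - B' (?x c) (?x d) ?p"
    if "c \<in> FN_coords K" "d \<in> FN_coords K" for c d
  proof -
    have "?x c \<in> FN_regular K" "?x d \<in> FN_regular K"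
      using that unfolding FN_space_def FN_regular_def by (auto intro: regular_functions.coord)
    then have "B' (?x d) (?x c) = (\<lambda>x\<in>FN_space K. - B' (?x c) (?x d) x)"
      using FN unfolding is_FN_bracket_def skew_biderivation_def by blast
    then show ?thesis using p by simp
  qed
  have self: "?br c c = B' (?x c) (?x c) ?p" if "c \<in> FN_coords K" for c
    using sk[OF that that] sk'[OF that that] by simp
  have S_in: "S j \<in> FN_coords K \<longleftrightarrow> j \<in> {1..2*K+2}" for j by (auto simp: FN_coords_def)
  have pS: "param K y (S j) = stokes K y j" if "j \<in> {1..2*K+2}" for j y
    using that by (simp add: param_def S_in)
  have pL: "param K y Lam = monodromy K y" for y by (simp add: param_def FN_coords_def)
  have ss: "?br (S j) (S l) = B' (?x (S j)) (?x (S l)) ?p"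
    if "j \<in> {1..2*K+2}" "l \<in> {1..2*K+2}" "j < l" for j l
  proof -
    have "B' (?x (S j)) (?x (S l)) = (\<lambda>x\<in>FN_space K. FN_ss K j l x)"
      using FN that unfolding is_FN_bracket_def by blast
    then show ?thesis using p br_stokes_stokes[OF K that y] by (simp add: pS[OF that(1)] pS[OF that(2)])
  qed
  have sl: "?br (S j) Lam = B' (?x (S j)) (?x Lam) ?p" if "j \<in> {1..2*K+2}" for j
  proof -
    have "B' (?x (S j)) (?x Lam) = (\<lambda>x\<in>FN_space K. FN_sl j x)"
      using FN that unfolding is_FN_bracket_def by blast
    then show ?thesis using p br_stokes_monodromy[OF K that y] by (simp add: pS[OF that] pL)
  qed
  show ?thesis
  proof (cases c; cases d)
    fix j l assume cd: "c = S j" "d = S l"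
    consider "j < l" | "l < j" | "j = l" by linarith
    then show ?thesis
      by cases (use cd c d S_in ss[of j l] ss[of l j] sk[of d c] sk'[of d c] self in auto)
  next
    fix j assume cd: "c = S j" "d = Lam"
    then show ?thesis using sl[of j] c S_in by blast
  next
    fix l assume cd: "c = Lam" "d = S l"
    then show ?thesis using sl[of l] c d S_in sk[of d c] sk'[of d c] by auto
  next
    assume "c = Lam" "d = Lam"
    then show ?thesis using self c by blast
  qed
qed

text \<open>At each point \<open>point_derivation_eqI\<close> is used twice: first in the left slot
  with a coordinate on the right, then in the right slot with an arbitrary left argument.\<close>

lemma pullback_bracket:
  assumes K: "K \<ge> 1" and FN: "is_FN_bracket K B'"
    and f: "f \<in> FN_regular K" and g: "g \<in> FN_regular K"
  shows "B (pullback K f) (pullback K g) = pullback K (B' f g)"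
proof
  fix y
  show "B (pullback K f) (pullback K g) y = pullback K (B' f g) y"
  proof (cases "y \<in> y_space K")
    \<comment> \<open>Off the space both sides are \<open>undefined\<close>, the left one because
      regular functions are extensional.\<close>
    case False
    have "B (pullback K f) (pullback K g) \<in> y_regular K"
      by (intro B_regular pullback_regular K f g)
    then have "B (pullback K f) (pullback K g) \<in> extensional (y_space K)"
      unfolding y_regular_def y_space_def by (rule regular_extensional)
    from extensional_arb[OF this False] show ?thesis
      using False by (simp add: pullback_def restrict_apply)
  next
    case y: True
    let ?x = "\<lambda>c. \<lambda>x\<in>FN_space K. x c :: complex"
    have x: "?x c \<in> FN_regular K" if "c \<in> FN_coords K" for c
      using that unfolding FN_space_def FN_regular_def by (rule regular_functions.coord)
    have eqI: "\<delta> h = \<delta>' h"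
      if "point_derivation (FN_space K) (FN_regular K) (param K y) \<delta>"
        and "point_derivation (FN_space K) (FN_regular K) (param K y) \<delta>'"
        and "\<And>c. c \<in> FN_coords K \<Longrightarrow> \<delta> (?x c) = \<delta>' (?x c)" and "h \<in> FN_regular K" for \<delta> \<delta>' h
    proof (rule point_derivation_eqI[of "{Lam}" "FN_coords K" "param K y" \<delta> \<delta>' h,
          folded FN_space_def FN_regular_def])
      show "{Lam} \<subseteq> FN_coords K" by (simp add: FN_coords_def)
    qed (fact that param_in_FN_space[OF y])+
    have B'_left: "point_derivation (FN_space K) (FN_regular K) (param K y) (\<lambda>f. B' f h (param K y))"
      and B'_right: "point_derivation (FN_space K) (FN_regular K) (param K y) (\<lambda>f. B' h f (param K y))"
      if "h \<in> FN_regular K" for h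
    proof -
      have "skew_biderivation (FN_space K) (FN_regular K) B'"
        using FN unfolding is_FN_bracket_def by (rule conjunct1)
      then have "derivation (FN_space K) (FN_regular K) (\<lambda>f. B' f h)"
        and "derivation (FN_space K) (FN_regular K) (\<lambda>f. B' h f)"
        using that unfolding skew_biderivation_def by blast+
      from this[THEN derivation_at_point, OF param_in_FN_space[OF y]]
      show "point_derivation (FN_space K) (FN_regular K) (param K y) (\<lambda>f. B' f h (param K y))"
        and "point_derivation (FN_space K) (FN_regular K) (param K y) (\<lambda>f. B' h f (param K y))" .
    qed
    have 1: "B (pullback K f) (pullback K (?x d)) y = B' f (?x d) (param K y)"
      if d: "d \<in> FN_coords K" for d
    proof (rule eqI[where \<delta> = "\<lambda>f. B (pullback K f) (pullback K (?x d)) y" and \<delta>' = "\<lambda>f. B' f (?x d) (param K y)"])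
      show "point_derivation (FN_space K) (FN_regular K) (param K y)
          (\<lambda>f. B (pullback K f) (pullback K (?x d)) y)"
        by (rule pullback_point_derivation[OF K y B_point_derivation(1)[OF pullback_regular[OF K x[OF d]] y]])
      fix c assume "c \<in> FN_coords K"
      then show "B (pullback K (?x c)) (pullback K (?x d)) y = B' (?x c) (?x d) (param K y)"
        using pullback_bracket_coord[OF K FN y _ d] unfolding pullback_coord br_def by blast
    qed (rule B'_left[OF x[OF d]] f)+
    have "B (pullback K f) (pullback K g) y = B' f g (param K y)"
    proof (rule eqI[where \<delta> = "\<lambda>g. B (pullback K f) (pullback K g) y" and \<delta>' = "\<lambda>g. B' f g (param K y)"])
      show "point_derivation (FN_space K) (FN_regular K) (param K y)
          (\<lambda>g. B (pullback K f) (pullback K g) y)"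
        by (rule pullback_point_derivation[OF K y B_point_derivation(2)[OF pullback_regular[OF K f] y]])
    qed (rule B'_right[OF f] g 1, assumption?)+
    then show ?thesis using y by (simp add: pullback_def)
  qed
qed

end

theorem theorem3p15:
  fixes K :: nat
    and B_y :: "((nat \<Rightarrow> complex) \<Rightarrow> complex) \<Rightarrow> ((nat \<Rightarrow> complex) \<Rightarrow> complex) \<Rightarrow> (nat \<Rightarrow> complex) \<Rightarrow> complex"
    and B_FN :: "((FN_coord \<Rightarrow> complex) \<Rightarrow> complex) \<Rightarrow> ((FN_coord \<Rightarrow> complex) \<Rightarrow> complex) \<Rightarrow> (FN_coord \<Rightarrow> complex) \<Rightarrow> complex"
  assumes "K \<ge> 1"
    and "is_y_bracket K B_y"
    and "is_FN_bracket K B_FN"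
  shows "param K \<in> y_space K \<rightarrow> FN_space K \<and>
    (\<forall>f\<in>FN_regular K. \<forall>g\<in>FN_regular K.
       B_y (pullback K f) (pullback K g) = pullback K (B_FN f g)) \<and>
    (\<forall>j\<in>{1..2*K+2}. \<forall>l\<in>{1..2*K+2}. j < l \<longrightarrow>
       B_y (\<lambda>y\<in>y_space K. stokes K y j) (\<lambda>y\<in>y_space K. stokes K y l)
         = (\<lambda>y\<in>y_space K. FN_ss K j l (param K y))) \<and>
    (\<forall>j\<in>{1..2*K+2}.
       B_y (\<lambda>y\<in>y_space K. stokes K y j) (\<lambda>y\<in>y_space K. monodromy K y)
         = (\<lambda>y\<in>y_space K. FN_sl j (param K y)))"
proof -
  interpret y_bracket K B_y by unfold_locales (rule assms(2))
  \<comment> \<open>Turns pointwise formulas on \<open>y_space K\<close> into equality of functions,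
    since a bracket of regular functions is extensional.\<close>
  have ext: "br f g = (\<lambda>y\<in>y_space K. h y)"
    if "reg f" "reg g" "\<And>y. y \<in> y_space K \<Longrightarrow> br f g y = h y" for f g h
  proof (rule extensionalityI)
    have "br f g \<in> y_regular K"
      using that(1,2) unfolding br_def reg_def by (rule B_regular)
    then show "br f g \<in> extensional (y_space K)"
      unfolding y_regular_def y_space_def by (rule regular_extensional)
  qed (use that(3) in auto)
  show ?thesis
  proof (intro conjI ballI impI)
    show "param K \<in> y_space K \<rightarrow> FN_space K" using param_in_FN_space by blast
  next
    fix f g assume "f \<in> FN_regular K" "g \<in> FN_regular K"
    then show "B_y (pullback K f) (pullback K g) = pullback K (B_FN f g)"
      by (rule pullback_bracket[OF assms(1,3)])
  next
    fix j l assume jl: "j \<in> {1..2*K+2}" "l \<in> {1..2*K+2}" "j < l"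
    show "B_y (\<lambda>y\<in>y_space K. stokes K y j) (\<lambda>y\<in>y_space K. stokes K y l)
        = (\<lambda>y\<in>y_space K. FN_ss K j l (param K y))"
      unfolding br_def[symmetric]
      by (intro ext reg_stokes br_stokes_stokes assms(1) jl)
  next
    fix j assume j: "j \<in> {1..2*K+2}"
    show "B_y (\<lambda>y\<in>y_space K. stokes K y j) (\<lambda>y\<in>y_space K. monodromy K y)
        = (\<lambda>y\<in>y_space K. FN_sl j (param K y))"
      unfolding br_def[symmetric]
      by (intro ext reg_stokes reg_monodromy br_stokes_monodromy assms(1) j)
  qed
qed

end
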